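(* The map ${}'\epsilon:\mathcal X_{N-2}\to E_N$ induces bijections $\mathcal X^+_{N-2}\to E_N^+$ and $\mathcal X^-_{N-2}\to E_N^-$; moreover, for every even integer $t$ it induces a bijection $\mathcal X^{t,+}_{N-2}\to E_N^{t,+}$ and a bijection $\mathcal X^{t,-}_{N-2}\to E_N^{t,-}$.
   Context: Let $N\ge 3$ be an odd integer and $F=\mathbb Z/2\mathbb Z$. For integers $i,j$ let $[i,j]=\{h\in\mathbb Z: i\le h\le j\}$ (empty if $i>j$). Let $S_N=[1,N]$. The set of all subsets of $S_N$ is an $F$-vector space with sum $X+X'=(X\cup X')-(X\cap X')$; let $E_N$ be the subspace of subsets of even cardinality. A $2$-element subset $\{i,j\}\subseteq S_N$ is written $ij$ when either ($i<j$ and $j-i$ odd) or ($i>j$ and $i-j$ even); each $2$-element subset has exactly one such writing. Let $\mathcal P_N$ be the set of all finite sets $B$ of pairwise disjoint $2$-element subsets of $S_N$; for $B\in\mathcal P_N$ let $\mathrm{supp}(B)=\bigcup_{X\in B}X$, $B^0=\{\{i,j\}\in B: i-j\text{ even}\}$, $B^1=\{\{i,j\}\in B: i-j\text{ odd}\}$. A set $X\subseteq S_N$ is $0$-covered (resp. $1$-covered) by $B^1$ if there are $a_1b_1,\dots,a_sb_s\in B^1$ ($s\ge 0$, so $a_r<b_r$) with $X=[a_1,b_1]\sqcup\dots\sqcup[a_s,b_s]$ (resp. $X=[a_1,b_1]\sqcup\dots\sqcup[a_s,b_s]\sqcup\{u\}$ for some $u$), disjoint unions. Let ${}^*\mathcal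 P_N$ be the set of $B\in\mathcal P_N$ such that: for every $ij\in B^1$ the set $[i+1,j-1]$ is $0$-covered by $B^1$; and there is a sequence $i_*(B)=(i_1,\dots,i_{2s})$ in $S_N$ with $B^0=\{i_{2s}i_1,i_{2s-1}i_2,\dots,i_{s+1}i_s\}$ (so $s=|B^0|$; the sequence is unique) such that, if $s\ge1$, each of $[i_1+1,i_2-1],\dots,[i_{s-1}+1,i_s-1],[i_{s+1}+1,i_{s+2}-1],\dots,[i_{2s-1}+1,i_{2s}-1]$ is $0$-covered by $B^1$. For $B\in{}^*\mathcal P_N$ with $i_*(B)=(i_1,\dots,i_{2s})$ consider: (I) $s=0$, or $s\ge1$ and $[1,i_1-1]$ and $[i_{2s}+1,N]$ are $0$-covered by $B^1$; (II) $N\notin\mathrm{supp}(B)$ and either $s=0$, or $s$ is odd and either (i) $[1,i_1-1]$ is $1$-covered and $[i_{2s}+1,N-1]$ is $0$-covered by $B^1$, or (ii) $[1,i_1-1]$ is $0$-covered and $[i_{2s}+1,N-1]$ is $1$-covered by $B^1$; (III) (I) holds and, if $s$ is even then $\{i,N\}\in B$ for some even $i$, if $s$ is odd then $\{i,N\}\in B$ for some odd $i$. Let $\mathcal X^+_{N-2}$, $\mathcal X^-_{N-2}$ be the sets of $B\in{}^*\mathcal P_N$ satisfying (II), (III) respectively, and $\mathcal X_{N-2}=\mathcal X^+_{N-2}\sqcup\mathcal X^-_{N-2}$. For $B\in\mathcal X^+_{N-2}$ with $s\ge1$ there is a unique $u_B$: in case (i), $u_B\in[1,i_1-1]$ with $[1,u_B-1]$,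 $[u_B+1,i_1-1]$ $0$-covered by $B^1$ ($u_B$ odd); in case (ii), $u_B\in[i_{2s}+1,N-1]$ with $[i_{2s}+1,u_B-1]$, $[u_B+1,N-1]$ $0$-covered by $B^1$ ($u_B$ even). For even $t$: $\mathcal X^{0,+}_{N-2}=\{B\in\mathcal X^+_{N-2}:|B^0|=0\}$; for $t\ge2$, $\mathcal X^{t,+}_{N-2}=\{B\in\mathcal X^+_{N-2}:|B^0|=t-1,\ u_B\text{ odd}\}$; for $t\le-2$, $\mathcal X^{t,+}_{N-2}=\{B\in\mathcal X^+_{N-2}:|B^0|=-t-1,\ u_B\text{ even}\}$; $\mathcal X^{0,-}_{N-2}=\{B\in\mathcal X^-_{N-2}:|B^0|=0\}$; for $t\ge2$, $\mathcal X^{t,-}_{N-2}=\{B\in\mathcal X^-_{N-2}:|B^0|=t,\ \{i,N\}\in B\text{ for some even }i\}$; for $t\le -2$, $\mathcal X^{t,-}_{N-2}=\{B\in\mathcal X^-_{N-2}:|B^0|=-t-1,\ \{i,N\}\in B\text{ for some odd }i\}$. Put $[[ij]]=[i,j]$ if $i<j$ and $[[ij]]=[i,N]\cup[1,j]$ if $i>j$. For $B\in\mathcal X_{N-2}$ define ${}'\epsilon(B)\in E_N$: ${}'\epsilon(B)=\sum_{ij\in B}[[ij]]$ if $B\in\mathcal X^-_{N-2}$ or if $B\in\mathcal X^+_{N-2}$ with $|B^0|=0$; ${}'\epsilon(B)=\sum_{ij\in B}[[ij]]+[u_B,N]$ if $B\in\mathcal X^+_{N-2}$, $|B^0|$ odd,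 $u_B$ even; ${}'\epsilon(B)=\sum_{ij\in B}[[ij]]+\{N\}+[1,u_B]$ if $B\in\mathcal X^+_{N-2}$, $|B^0|$ odd, $u_B$ odd. For $X\in E_N$ let $\gamma(X)=|\{x\in X: x\text{ even}\}|-|\{x\in X:x\text{ odd}\}|$. Let $E_N^+=\{X\in E_N:N\notin X\}$, $E_N^-=\{X\in E_N:N\in X\}$, and for even $t$ let $E_N^{t,\pm}=\{X\in E_N^{\pm}:\gamma(X)=t\}$. *)

theory Defs
  imports Main
begin

(* S_N = {1..N} (natural numbers); a 2-element subset {i,j} is "written ij" iff wr i j *)
definition wr :: "nat \<Rightarrow> nat \<Rightarrow> bool" where
  "wr i j \<longleftrightarrow> (i < j \<and> odd (j - i)) \<or> (j < i \<and> even (i - j))"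

definition PN :: "nat \<Rightarrow> nat set set set" where
  "PN N = {B. finite B \<and> (\<forall>X\<in>B. X \<subseteq> {1..N} \<and> card X = 2) \<and> pairwise disjnt B}"

definition suppB :: "nat set set \<Rightarrow> nat set" where
  "suppB B = \<Union>B"

definition Bzero :: "nat set set \<Rightarrow> nat set set" where
  "Bzero B = {X\<in>B. \<exists>i j. X = {i,j} \<and> i \<noteq> j \<and> even (int i - int j)}"

definition Bone :: "nat set set \<Rightarrow> nat set set" where
  "Bone B = {X\<in>B. \<exists>i j. X = {i,j} \<and> i \<noteq> j \<and> odd (int i - int j)}"

(* the elements ab of B^1, as pairs (a,b) with a < b *)
definition B1pairs :: "nat set set \<Rightarrow> (nat \<times> nat) set" where
  "B1pairs B = {(a,b). {a,b} \<in> Bone B \<and> wr a b}"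

definition cov0 :: "nat set set \<Rightarrow> nat set \<Rightarrow> bool" where
  "cov0 B X \<longleftrightarrow> (\<exists>C. finite C \<and> C \<subseteq> B1pairs B \<and>
      (\<forall>p\<in>C. \<forall>q\<in>C. p \<noteq> q \<longrightarrow> disjnt {fst p..snd p} {fst q..snd q}) \<and>
      X = (\<Union>p\<in>C. {fst p..snd p}))"

definition cov1 :: "nat set set \<Rightarrow> nat set \<Rightarrow> bool" where
  "cov1 B X \<longleftrightarrow> (\<exists>C u. finite C \<and> C \<subseteq> B1pairs B \<and>
      (\<forall>p\<in>C. \<forall>q\<in>C. p \<noteq> q \<longrightarrow> disjnt {fst p..snd p} {fst q..snd q}) \<and>
      u \<notin> (\<Union>p\<in>C. {fst p..snd p}) \<and>
      X = (\<Union>p\<in>C. {fst p..snd p}) \<union> {u})"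

definition istar_seq :: "nat \<Rightarrow> nat set set \<Rightarrow> nat list \<Rightarrow> bool" where
  "istar_seq N B l \<longleftrightarrow> (let s = card (Bzero B) in
      length l = 2 * s \<and> sorted_wrt (<) l \<and> set l \<subseteq> {1..N} \<and>
      Bzero B = {{l ! (2*s - 1 - k), l ! k} | k. k < s} \<and>
      (\<forall>k<s. wr (l ! (2*s - 1 - k)) (l ! k)) \<and>
      (\<forall>k. k + 1 < 2 * s \<and> k + 1 \<noteq> s \<longrightarrow> cov0 B {l ! k + 1 .. l ! (k+1) - 1}))"

definition StarP :: "nat \<Rightarrow> nat set set set" where
  "StarP N = {B \<in> PN N. (\<forall>i j. (i,j) \<in> B1pairs B \<longrightarrow> cov0 B {i+1..j-1}) \<and>
                        (\<exists>l. istar_seq N B l)}"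

definition iseq :: "nat \<Rightarrow> nat set set \<Rightarrow> nat list" where
  "iseq N B = (THE l. istar_seq N B l)"

definition condI :: "nat \<Rightarrow> nat set set \<Rightarrow> bool" where
  "condI N B \<longleftrightarrow> (let l = iseq N B in
     card (Bzero B) = 0 \<or> (cov0 B {1 .. hd l - 1} \<and> cov0 B {last l + 1 .. N}))"

definition case_i :: "nat \<Rightarrow> nat set set \<Rightarrow> bool" where
  "case_i N B \<longleftrightarrow> (let l = iseq N B in
     cov1 B {1 .. hd l - 1} \<and> cov0 B {last l + 1 .. N - 1})"

definition case_ii :: "nat \<Rightarrow> nat set set \<Rightarrow> bool" where
  "case_ii N B \<longleftrightarrow> (let l = iseq N B in
     cov0 B {1 .. hd l - 1} \<and> cov1 B {last l + 1 .. N - 1})"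

definition condII :: "nat \<Rightarrow> nat set set \<Rightarrow> bool" where
  "condII N B \<longleftrightarrow> N \<notin> suppB B \<and>
     (card (Bzero B) = 0 \<or> (odd (card (Bzero B)) \<and> (case_i N B \<or> case_ii N B)))"

definition condIII :: "nat \<Rightarrow> nat set set \<Rightarrow> bool" where
  "condIII N B \<longleftrightarrow> condI N B \<and>
     (even (card (Bzero B)) \<longrightarrow> (\<exists>i. even i \<and> {i, N} \<in> B)) \<and>
     (odd (card (Bzero B)) \<longrightarrow> (\<exists>i. odd i \<and> {i, N} \<in> B))"

definition Xp :: "nat \<Rightarrow> nat set set set" where
  "Xp N = {B \<in> StarP N. condII N B}"

definition Xm :: "nat \<Rightarrow> nat set set set" where
  "Xm N = {B \<in> StarP N. condIII N B}"

definition XX :: "nat \<Rightarrow> nat set set set" where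
  "XX N = Xp N \<union> Xm N"

definition uB :: "nat \<Rightarrow> nat set set \<Rightarrow> nat" where
  "uB N B = (let l = iseq N B in
     if case_i N B
     then (THE u. u \<in> {1 .. hd l - 1} \<and> cov0 B {1 .. u - 1} \<and> cov0 B {u + 1 .. hd l - 1})
     else (THE u. u \<in> {last l + 1 .. N - 1} \<and> cov0 B {last l + 1 .. u - 1} \<and> cov0 B {u + 1 .. N - 1}))"

definition Xtp :: "nat \<Rightarrow> int \<Rightarrow> nat set set set" where
  "Xtp N t = (if t = 0 then {B \<in> Xp N. card (Bzero B) = 0}
     else if t \<ge> 2 then {B \<in> Xp N. int (card (Bzero B)) = t - 1 \<and> odd (uB N B)}
     else if t \<le> -2 then {B \<in> Xp N. int (card (Bzero B)) = - t - 1 \<and> even (uB N B)}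
     else {})"

definition Xtm :: "nat \<Rightarrow> int \<Rightarrow> nat set set set" where
  "Xtm N t = (if t = 0 then {B \<in> Xm N. card (Bzero B) = 0}
     else if t \<ge> 2 then {B \<in> Xm N. int (card (Bzero B)) = t \<and> (\<exists>i. even i \<and> {i, N} \<in> B)}
     else if t \<le> -2 then {B \<in> Xm N. int (card (Bzero B)) = - t - 1 \<and> (\<exists>i. odd i \<and> {i, N} \<in> B)}
     else {})"

definition brk :: "nat \<Rightarrow> nat \<Rightarrow> nat \<Rightarrow> nat set" where
  "brk N i j = (if i < j then {i..j} else {i..N} \<union> {1..j})"

(* sum X + X' in the F_2-vector space of subsets *)
definition sdiff :: "nat set \<Rightarrow> nat set \<Rightarrow> nat set" where
  "sdiff X Y = (X - Y) \<union> (Y - X)"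

(* sum_{ij \<in> B} [[ij]] over F_2 *)
definition wsum :: "nat \<Rightarrow> nat set set \<Rightarrow> nat set" where
  "wsum N B = {x. odd (card {p. {fst p, snd p} \<in> B \<and> wr (fst p) (snd p) \<and> x \<in> brk N (fst p) (snd p)})}"

definition eps :: "nat \<Rightarrow> nat set set \<Rightarrow> nat set" where
  "eps N B = (if B \<in> Xm N \<or> card (Bzero B) = 0 then wsum N B
     else if even (uB N B) then sdiff (wsum N B) {uB N B .. N}
     else sdiff (sdiff (wsum N B) {N}) {1 .. uB N B})"

definition EN :: "nat \<Rightarrow> nat set set" where
  "EN N = {X. X \<subseteq> {1..N} \<and> even (card X)}"

definition gam :: "nat set \<Rightarrow> int" where
  "gam X = int (card {x\<in>X. even x}) - int (card {x\<in>X. odd x})"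

definition ENp :: "nat \<Rightarrow> nat set set" where
  "ENp N = {X \<in> EN N. N \<notin> X}"

definition ENm :: "nat \<Rightarrow> nat set set" where
  "ENm N = {X \<in> EN N. N \<in> X}"

definition ENtp :: "nat \<Rightarrow> int \<Rightarrow> nat set set" where
  "ENtp N t = {X \<in> ENp N. gam X = t}"

definition ENtm :: "nat \<Rightarrow> int \<Rightarrow> nat set set" where
  "ENtm N t = {X \<in> ENm N. gam X = t}"

end

theory Submission
  imports Defs
begin

text \<open>Add the pair of \<open>N\<close> and the distinguished point \<open>u\<^sub>B\<close> to each \<open>B\<close> of the plus
  family with \<open>|B\<^sup>0| > 0\<close>. Then both families together consist of the partial
  noncrossing matchings of the circle \<open>1, \<dots>, N\<close> all of whose arcs \<open>[[ij]]\<close> are unions of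
  blocks, and \<open>'\<epsilon>\<close> becomes \<open>B \<mapsto> \<Sum> [[ij]]\<close>. Such a matching is recovered from the function
  counting the arcs over each gap between neighbouring points. This is a closed lattice path
  whose steps are \<open>\<plusminus>1\<close>, or flat at height \<open>0\<close>, and the sum of the arcs is the set of those steps
  whose higher end is odd. In a signed coordinate the steps are reflections of the integers, so a
  subset determines a closed path exactly when the fixed-point equation of a composition of \<open>N\<close>
  reflections is solvable. As \<open>N\<close> is odd, this happens for exactly the even subsets \<open>X\<close>; the
  starting point of the path is then \<open>\<gamma>(X) / 2\<close>, which gives \<open>|B\<^sup>0|\<close>.\<close>

section \<open>Arcs and depth\<close>

text \<open>Two points i, j bound two closed arcs of the circle, with N + 2 points in all. As N is
  odd, exactly one of them has an even number of points, and \<open>wr i j\<close> writes the pair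
  so that this one is [[ij]]; only an arc of even size can be a union of blocks. For the same parity
  reason every matching leaves some point v unmatched, and no union of blocks contains v. Cutting
  the circle at v is what links it to the linear conditions of the definitions: in a good matching
  every even pair ij has j < v < i, so the even pairs are nested, while no odd pair straddles v.

  The minus family is good as it stands. The obstacle is a B of the plus family with B^0 nonempty:
  each arc of an even pair contains N and u_B, both unmatched, so it is not a union of blocks.
  Joining these two points repairs exactly this, and the correction terms [u_B, N] and {N} +
  [1, u_B] in \<open>eps\<close> are the arcs [[u_B N]] and [[N u_B]] of the new pair.\<close>

definition arcs :: "nat set set \<Rightarrow> (nat \<times> nat) set" where
  "arcs B = {(i, j). {i, j} \<in> B \<and> wr i j}"

text \<open>The gap \<open>x\<close> lies between the points \<open>x\<close> and \<open>x + 1\<close> of the circle; the gap between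
  \<open>N\<close> and \<open>1\<close> carries both labels \<open>0\<close> and \<open>N\<close>.\<close>
definition gaps :: "nat \<Rightarrow> nat \<Rightarrow> nat \<Rightarrow> nat set" where
  "gaps N i j = (if i < j then {i..<j} else {i..N} \<union> {..<j})"

definition depth :: "nat \<Rightarrow> nat set set \<Rightarrow> nat \<Rightarrow> nat" where
  "depth N B x = card {p \<in> arcs B. x \<in> gaps N (fst p) (snd p)}"

text \<open>A union of blocks. For pairwise disjoint blocks this notion is stable under union and
  difference, and every such set of pairs has even size; the interval coverings of the definitions
  are translated into it.\<close>

definition saturated :: "nat set set \<Rightarrow> nat set \<Rightarrow> bool" where
  "saturated B S \<longleftrightarrow> (\<forall>x\<in>S. \<exists>P\<in>B. x \<in> P \<and> P \<subseteq> S)"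

definition Good :: "nat \<Rightarrow> nat set set set" where
  "Good N = {B \<in> PN N. \<forall>i j. (i, j) \<in> arcs B \<longrightarrow> saturated B (brk N i j)}"

lemma wr_antisym: "wr i j \<Longrightarrow> \<not> wr j i"
  by (auto simp: wr_def)

lemma wr_total: "i \<noteq> j \<Longrightarrow> wr i j \<or> wr j i"
  by (cases i j rule: linorder_cases) (auto simp: wr_def)

lemma wr_neq: "wr i j \<Longrightarrow> i \<noteq> j"
  by (auto simp: wr_def)

lemma wr_gt: "wr i j \<Longrightarrow> j < i \<Longrightarrow> j + 2 \<le> i"
proof -
  assume "wr i j" "j < i"
  then have "even (i - j)" "i - j \<noteq> 0" by (auto simp: wr_def)
  then have "i - j \<ge> 2" by presburger
  then show ?thesis using \<open>j < i\<close> by linarith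
qed

lemma PN_arc:
  assumes "B \<in> PN N" "(i, j) \<in> arcs B"
  shows "1 \<le> i" "i \<le> N" "1 \<le> j" "j \<le> N" "i \<noteq> j" "{i, j} \<in> B" "wr i j"
  using assms wr_neq[of i j] by (auto simp: PN_def arcs_def dest!: bspec[of B _ "{i,j}"])

lemma PN_pair:
  assumes "B \<in> PN N" "P \<in> B"
  obtains i j where "(i, j) \<in> arcs B" "P = {i, j}"
proof -
  have "card P = 2" using assms by (auto simp: PN_def)
  then obtain i j where "P = {i, j}" "i \<noteq> j" by (auto simp: card_2_iff)
  then have "(i, j) \<in> arcs B \<or> (j, i) \<in> arcs B"
    using wr_total[of i j] assms(2) by (auto simp: arcs_def insert_commute)
  then show thesis using that[of i j] that[of j i] \<open>P = {i, j}\<close> by (auto simp: insert_commute)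
qed

lemma PN_disjoint:
  assumes "B \<in> PN N" "P \<in> B" "Q \<in> B" "x \<in> P" "x \<in> Q"
  shows "P = Q"
  using assms unfolding PN_def pairwise_def disjnt_iff by blast

lemma arcs_eq:
  assumes "B \<in> PN N" "(i, j) \<in> arcs B" "(k, l) \<in> arcs B" "x \<in> {i, j}" "x \<in> {k, l}"
  shows "i = k \<and> j = l"
proof -
  have "{i, j} = {k, l}" using PN_disjoint[OF assms(1) _ _ assms(4,5)] assms by (auto simp: arcs_def)
  then show ?thesis using assms wr_antisym by (auto simp: arcs_def doubleton_eq_iff)
qed

lemma finite_arcs: "B \<in> PN N \<Longrightarrow> finite (arcs B)"
  using PN_arc by (intro finite_subset[of "arcs B" "{1..N} \<times> {1..N}"]) fastforce+

lemma even_card_saturated: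
  assumes "B \<in> PN N" "saturated B S"
  shows "even (card S)"
proof -
  let ?C = "{P \<in> B. P \<subseteq> S}"
  have S: "S = \<Union>?C" using assms(2) by (auto simp: saturated_def)
  have "card (\<Union>?C) = sum card ?C"
    using assms(1) by (intro card_Union_disjoint) (auto simp: PN_def pairwise_def intro: finite_subset)
  also have "\<dots> = (\<Sum>P\<in>?C. 2)"
    using assms(1) by (intro sum.cong) (auto simp: PN_def)
  finally show ?thesis using S by simp
qed

lemma saturated_Union: "saturated B (\<Union>B)"
  by (auto simp: saturated_def)

text \<open>The matched points form a disjoint union of two-element blocks, so their number is even
  while N is odd.\<close>

lemma free_point:
  assumes "odd N" "B \<in> PN N"
  obtains v where "1 \<le> v" "v \<le> N" "v \<notin> \<Union>B"
proof -
  have "\<Union>B \<noteq> {1..N}"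
    using even_card_saturated[OF assms(2) saturated_Union] assms(1) by auto
  moreover have "\<Union>B \<subseteq> {1..N}" using assms(2) by (auto simp: PN_def)
  ultimately obtain v where "v \<in> {1..N}" "v \<notin> \<Union>B" by blast
  then show thesis using that by auto
qed

lemma Good_PN: "B \<in> Good N \<Longrightarrow> B \<in> PN N"
  by (simp add: Good_def)

lemma Good_saturated: "B \<in> Good N \<Longrightarrow> (i, j) \<in> arcs B \<Longrightarrow> saturated B (brk N i j)"
  by (simp add: Good_def)

lemma Good_free:
  assumes "B \<in> Good N" "(i, j) \<in> arcs B" "x \<notin> \<Union>B"
  shows "x \<notin> brk N i j"
  using Good_saturated[OF assms(1,2)] assms(3) unfolding saturated_def by blast

text \<open>This is the absence of crossings: blocks are disjoint, so a block that meets a union of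
  blocks is one of them.\<close>

lemma Good_brk_iff:
  assumes "B \<in> Good N" "(i, j) \<in> arcs B" "(k, l) \<in> arcs B"
  shows "k \<in> brk N i j \<longleftrightarrow> l \<in> brk N i j"
proof -
  have *: "{k, l} \<subseteq> brk N i j" if x: "x \<in> brk N i j" "x \<in> {k, l}" for x
  proof -
    obtain P where "P \<in> B" "x \<in> P" "P \<subseteq> brk N i j"
      using Good_saturated[OF assms(1,2)] x(1) unfolding saturated_def by blast
    moreover have "{k, l} \<in> B" using assms by (auto simp: arcs_def)
    ultimately have "P = {k, l}" by (intro PN_disjoint[OF Good_PN[OF assms(1)] _ _ _ x(2)])
    then show ?thesis using \<open>P \<subseteq> brk N i j\<close> by simp
  qed
  show ?thesis using *[of k] *[of l] by blast
qed

text \<open>A point that is no end of an arc lies on the same side of it as both neighbouring gaps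
  (with \<open>brk_gaps\<close>), so the depth changes at a point only through the arc that ends
  there.\<close>

lemma gaps_step:
  assumes "x \<noteq> i" "x \<noteq> j" "1 \<le> x" "x \<le> N"
  shows "x \<in> gaps N i j \<longleftrightarrow> x - 1 \<in> gaps N i j"
  using assms by (auto simp: gaps_def)

lemma brk_gaps:
  assumes "x \<noteq> i" "x \<noteq> j" "1 \<le> x" "x \<le> N"
  shows "x \<in> brk N i j \<longleftrightarrow> x \<in> gaps N i j"
  using assms by (auto simp: gaps_def brk_def)

lemma wsum_eq: "wsum N B = {x. odd (card {p \<in> arcs B. x \<in> brk N (fst p) (snd p)})}"
  by (auto simp: wsum_def arcs_def case_prod_beta conj_assoc)

lemma card_Collect_except:
  assumes "finite S" "q \<in> S" "\<not> R q" "\<And>p. p \<in> S \<Longrightarrow> p \<noteq> q \<Longrightarrow> Q p \<longleftrightarrow> R p"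
  shows "card {p \<in> S. Q p} = card {p \<in> S. R p} + of_bool (Q q)"
proof -
  have "{p \<in> S. Q p} = (if Q q then insert q {p \<in> S. R p} else {p \<in> S. R p})"
    using assms(2-4) by (intro set_eqI) (metis (mono_tags, lifting) insert_iff mem_Collect_eq)
  then show ?thesis using assms by simp
qed

text \<open>The number a counts the arcs through x that do not end at x; they cover both gaps next
  to x. The one arc ending at x, if any, also contains x and covers exactly one of the two gaps: the
  one after x if x is written first, the one before x if it is written last.\<close>

lemma depth_cases:
  assumes B: "B \<in> PN N" and x: "1 \<le> x" "x \<le> N"
  defines "a \<equiv> card {p \<in> arcs B. x \<noteq> fst p \<and> x \<noteq> snd p \<and> x \<in> brk N (fst p) (snd p)}"
  shows "(x, y) \<in> arcs B \<Longrightarrow> depth N B (x - 1) = a \<and> depth N B x = Suc a \<and> (x \<in> wsum N B \<longleftrightarrow> even a)"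
    and "(y, x) \<in> arcs B \<Longrightarrow> depth N B x = a \<and> depth N B (x - 1) = Suc a \<and> (x \<in> wsum N B \<longleftrightarrow> even a)"
    and "x \<notin> \<Union>B \<Longrightarrow> depth N B x = a \<and> depth N B (x - 1) = a \<and> (x \<in> wsum N B \<longleftrightarrow> odd a)"
proof -
  have fin: "finite (arcs B)" using finite_arcs[OF B] .
  have g: "x \<in> gaps N (fst p) (snd p) \<longleftrightarrow> x \<in> brk N (fst p) (snd p)"
    "x - 1 \<in> gaps N (fst p) (snd p) \<longleftrightarrow> x \<in> brk N (fst p) (snd p)"
    if "x \<noteq> fst p" "x \<noteq> snd p" for p
    using gaps_step[OF that x] brk_gaps[OF that x] by blast+
  have cnt: "depth N B (x - 1) = a + of_bool (x - 1 \<in> gaps N (fst q) (snd q))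
      \<and> depth N B x = a + of_bool (x \<in> gaps N (fst q) (snd q))
      \<and> (x \<in> wsum N B \<longleftrightarrow> odd (a + of_bool (x \<in> brk N (fst q) (snd q))))"
    if q: "q \<in> arcs B" "x = fst q \<or> x = snd q" for q
  proof -
    have off: "x \<noteq> fst p \<and> x \<noteq> snd p" if "p \<in> arcs B" "p \<noteq> q" for p
    proof (rule ccontr)
      assume "\<not> ?thesis"
      then have "x \<in> {fst p, snd p}" "x \<in> {fst q, snd q}" using q by blast+
      then have "fst p = fst q \<and> snd p = snd q" 
        using arcs_eq[OF B, of "fst p" "snd p" "fst q" "snd q" x] that q by simp
      then show False using that by (simp add: prod_eq_iff)
    qed
    have "\<not> (x \<noteq> fst q \<and> x \<noteq> snd q \<and> x \<in> brk N (fst q) (snd q))" using q(2) by blast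
    \<comment> \<open>In each of the three counts below, q is the only arc that may be counted
      without being counted in a.\<close>
    note except = card_Collect_except[OF fin q(1),
      where R = "\<lambda>p. x \<noteq> fst p \<and> x \<noteq> snd p \<and> x \<in> brk N (fst p) (snd p)", OF this]
    have "depth N B (x - 1) = a + of_bool (x - 1 \<in> gaps N (fst q) (snd q))"
      unfolding depth_def a_def by (rule except) (use off g in blast)
    moreover have "depth N B x = a + of_bool (x \<in> gaps N (fst q) (snd q))"
      unfolding depth_def a_def by (rule except) (use off g in blast)
    moreover have "card {p \<in> arcs B. x \<in> brk N (fst p) (snd p)} = a + of_bool (x \<in> brk N (fst q) (snd q))"
      unfolding a_def by (rule except) (use off in blast)
    ultimately show ?thesis by (simp add: wsum_eq)
  qed
  show "depth N B (x - 1) = a \<and> depth N B x = Suc a \<and> (x \<in> wsum N B \<longleftrightarrow> even a)"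
    if xy: "(x, y) \<in> arcs B"
  proof -
    note y = PN_arc[OF B xy]
    have "x \<in> brk N x y" "x \<in> gaps N x y" "x - 1 \<notin> gaps N x y"
      using y wr_gt[of x y] by (auto simp: brk_def gaps_def)
    then show ?thesis using cnt[OF xy] by simp
  qed
  show "depth N B x = a \<and> depth N B (x - 1) = Suc a \<and> (x \<in> wsum N B \<longleftrightarrow> even a)"
    if yx: "(y, x) \<in> arcs B"
  proof -
    note y = PN_arc[OF B yx]
    have "x \<in> brk N y x" "x - 1 \<in> gaps N y x" "x \<notin> gaps N y x"
      using y by (auto simp: brk_def gaps_def)
    then show ?thesis using cnt[OF yx] by simp
  qed
  show "depth N B x = a \<and> depth N B (x - 1) = a \<and> (x \<in> wsum N B \<longleftrightarrow> odd a)"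
    if "x \<notin> \<Union>B"
  proof -
    have n: "x \<noteq> fst p \<and> x \<noteq> snd p" if "p \<in> arcs B" for p
      using that \<open>x \<notin> \<Union>B\<close> by (auto simp: arcs_def)
    have "depth N B x = a" "depth N B (x - 1) = a"
      "card {p \<in> arcs B. x \<in> brk N (fst p) (snd p)} = a"
      unfolding depth_def a_def by (rule arg_cong[where f = card], rule Collect_cong, use n g in blast)+
    then show ?thesis by (simp add: wsum_eq)
  qed
qed

lemma Good_depth_free:
  assumes "B \<in> Good N" "1 \<le> x" "x \<le> N" "x \<notin> \<Union>B"
  shows "depth N B x = 0 \<and> depth N B (x - 1) = 0 \<and> x \<notin> wsum N B"
proof -
  have "{p \<in> arcs B. x \<noteq> fst p \<and> x \<noteq> snd p \<and> x \<in> brk N (fst p) (snd p)} = {}"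
    using Good_free[OF assms(1) _ assms(4)] by auto
  then show ?thesis using depth_cases(3)[OF Good_PN[OF assms(1)] assms(2,3,4)]
    by (metis card.empty even_zero)
qed

lemma in_Union_arcs:
  assumes "B \<in> PN N" "x \<in> \<Union>B"
  obtains y where "(x, y) \<in> arcs B" | y where "(y, x) \<in> arcs B"
  using assms PN_pair by (metis UnionE empty_iff insert_iff)

section \<open>Closed lattice paths and reflections of the integers\<close>

definition admissible :: "nat \<Rightarrow> (nat \<Rightarrow> nat) \<Rightarrow> bool" where
  "admissible N d \<longleftrightarrow> d N = d 0 \<and>
     (\<forall>x\<in>{1..N}. d x = Suc (d (x - 1)) \<or> d (x - 1) = Suc (d x) \<or> (d x = 0 \<and> d (x - 1) = 0))"

text \<open>The arcs containing a matched point are those over the higher of its two gaps, its own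
  arc included; hence the maximum. At an unmatched point of a good matching both heights are
  0.\<close>

definition path_set :: "nat \<Rightarrow> (nat \<Rightarrow> nat) \<Rightarrow> nat set" where
  "path_set N d = {x \<in> {1..N}. odd (max (d (x - 1)) (d x))}"

lemma wsum_subset: 
  assumes "B \<in> PN N" shows "wsum N B \<subseteq> {1..N}"
proof
  fix x assume "x \<in> wsum N B"
  then have "{p \<in> arcs B. x \<in> brk N (fst p) (snd p)} \<noteq> {}" by (force simp: wsum_eq)
  then obtain i j where "(i, j) \<in> arcs B" "x \<in> brk N i j" by auto
  then show "x \<in> {1..N}" using PN_arc[OF assms, of i j] by (auto simp: brk_def split: if_splits)
qed

lemma depth_0: "B \<in> PN N \<Longrightarrow> depth N B N = depth N B 0"
  unfolding depth_def by (rule arg_cong[where f = card]) (use PN_arc in \<open>fastforce simp: gaps_def\<close>)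

lemma Good_admissible:
  assumes "B \<in> Good N"
  shows "admissible N (depth N B)" and "wsum N B = path_set N (depth N B)"
proof -
  note PN = Good_PN[OF assms]
  have *: "(depth N B x = Suc (depth N B (x - 1)) \<or> depth N B (x - 1) = Suc (depth N B x)
      \<or> (depth N B x = 0 \<and> depth N B (x - 1) = 0))
     \<and> (x \<in> wsum N B \<longleftrightarrow> odd (max (depth N B (x - 1)) (depth N B x)))" if x: "1 \<le> x" "x \<le> N" for x
  proof (cases "x \<in> \<Union>B")
    case True
    then show ?thesis
      by (rule in_Union_arcs[OF PN])
        (use depth_cases(1)[OF PN x] depth_cases(2)[OF PN x] in \<open>fastforce simp: max_def\<close>)+
  next
    case False
    then show ?thesis using Good_depth_free[OF assms x] by auto
  qed
  show "admissible N (depth N B)" using * depth_0[OF PN] by (auto simp: admissible_def)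
  show "wsum N B = path_set N (depth N B)" using * wsum_subset[OF PN] by (auto simp: path_set_def)
qed

text \<open>In the coordinate \<open>zig\<close> every step of an admissible path becomes a reflection
  \<open>m \<mapsto> - m\<close> or \<open>m \<mapsto> - m - 1\<close> of the integers; a composition of an odd number of these
  has at most one fixed point, which determines the path from its set.\<close>
definition zig :: "nat \<Rightarrow> int" where
  "zig k = (if even k then int (k div 2) else - int ((k + 1) div 2))"

lemma zig_inj: "zig k = zig l \<Longrightarrow> k = l"
  unfolding zig_def by (auto split: if_splits elim!: evenE oddE)

text \<open>Heights 2j and 2j + 1 have coordinates j and -j - 1, exchanged by m |-> -m - 1; heights
  2j - 1 and 2j have coordinates -j and j, exchanged by m |-> -m, which also fixes the height 0 of
  the flat steps. So the parity of the higher end selects the reflection.\<close>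

lemma zig_step:
  assumes "admissible N d" "1 \<le> x" "x \<le> N"
  shows "zig (d x) = - zig (d (x - 1)) - of_bool (x \<in> path_set N d)"
proof -
  have "d x = Suc (d (x - 1)) \<or> d (x - 1) = Suc (d x) \<or> (d x = 0 \<and> d (x - 1) = 0)"
    using assms by (auto simp: admissible_def)
  moreover have "x \<in> path_set N d \<longleftrightarrow> odd (max (d (x - 1)) (d x))"
    using assms by (auto simp: path_set_def)
  ultimately show ?thesis
    by (elim disjE) (auto simp: zig_def max_def elim!: evenE oddE)
qed

definition gamma_upto :: "nat set \<Rightarrow> nat \<Rightarrow> int" where
  "gamma_upto X x = (\<Sum>y\<in>{1..x}. (-1) ^ y * of_bool (y \<in> X))"

lemma gamma_upto_Suc: "gamma_upto X (Suc x) = gamma_upto X x + (-1) ^ (Suc x) * of_bool (Suc x \<in> X)"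
  by (simp add: gamma_upto_def)

lemma gam_eq_upto:
  assumes "X \<subseteq> {1..N}"
  shows "gam X = gamma_upto X N"
proof -
  have fin: "finite X" using assms finite_subset by blast
  have "gamma_upto X N = (\<Sum>y\<in>X. (-1) ^ y)"
    unfolding gamma_upto_def using assms
    by (intro sum.mono_neutral_cong_right) auto
  also have "\<dots> = (\<Sum>y\<in>{x\<in>X. even x}. (-1) ^ y) + (\<Sum>y\<in>{x\<in>X. odd x}. (-1) ^ y)"
    using fin by (subst sum.union_disjoint[symmetric]) (auto intro: sum.cong)
  also have "(\<Sum>y\<in>{x\<in>X. even x}. (-1) ^ y) = int (card {x\<in>X. even x})"
    by simp
  also have "(\<Sum>y\<in>{x\<in>X. odd x}. (-1) ^ y) = - int (card {x\<in>X. odd x})"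
    by simp
  finally show ?thesis by (simp add: gam_def)
qed

lemma even_gam_iff:
  assumes "finite X"
  shows "even (gam X) \<longleftrightarrow> even (card X)"
proof -
  have "card X = card {x\<in>X. even x} + card {x\<in>X. odd x}"
    using assms by (subst card_Un_disjoint[symmetric]) (auto intro: arg_cong[where f = card])
  then show ?thesis by (simp add: gam_def)
qed

text \<open>Each reflection changes the sign of what has accumulated, so the translations by -1
  enter with alternating signs and add up to a partial value of \<open>gam\<close>.\<close>

lemma zig_path:
  assumes "admissible N d" "x \<le> N"
  shows "zig (d x) = (-1) ^ x * (zig (d 0) - gamma_upto (path_set N d) x)"
  using assms(2)
proof (induction x)
  case 0
  then show ?case by (simp add: gamma_upto_def)
next
  case (Suc x)
  then have "zig (d (Suc x)) = - zig (d x) - of_bool (Suc x \<in> path_set N d)"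
    using zig_step[OF assms(1), of "Suc x"] by simp
  then show ?case using Suc by (simp add: gamma_upto_Suc algebra_simps flip: power_add mult_2)
qed

text \<open>For odd N the composite of all steps is z |-> g - z, where g is \<open>gam\<close> of
  the path set; that the path closes up says that its start z is the fixed point.\<close>

lemma gam_path_set:
  assumes "odd N" "admissible N d"
  shows "gam (path_set N d) = 2 * zig (d 0)"
proof -
  have "path_set N d \<subseteq> {1..N}" by (auto simp: path_set_def)
  then have "gam (path_set N d) = gamma_upto (path_set N d) N" by (rule gam_eq_upto)
  then have "zig (d 0) = - (zig (d 0) - gam (path_set N d))"
    using zig_path[OF assms(2), of N] assms by (simp add: admissible_def)
  then show ?thesis by linarith
qed

lemma path_set_inj:
  assumes "odd N" "admissible N d" "admissible N e" "path_set N d = path_set N e" "x \<le> N"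
  shows "d x = e x"
  using zig_path[OF assms(2,5)] zig_path[OF assms(3,5)] gam_path_set[OF assms(1,2)]
    gam_path_set[OF assms(1,3)] assms(4) by (intro zig_inj) simp

text \<open>The inverse of \<open>zig\<close>: nonnegative integers come from even heights, negative
  ones from odd heights.\<close>

definition zag :: "int \<Rightarrow> nat" where
  "zag m = (if m \<ge> 0 then nat (2 * m) else nat (- 2 * m - 1))"

lemma zag_step:
  assumes "m = - k - of_bool b"
  shows "(zag m = Suc (zag k) \<or> zag k = Suc (zag m) \<or> (zag m = 0 \<and> zag k = 0))
    \<and> (b \<longleftrightarrow> odd (max (zag k) (zag m)))"
  using assms unfolding zag_def max_def by (cases b) (auto simp: even_nat_iff nat_diff_distrib split: if_splits)

lemma path_exists:
  assumes "odd N" "X \<in> EN N"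
  obtains d where "admissible N d" "path_set N d = X"
proof -
  \<comment> \<open>The start \<open>gam X div 2\<close> is the fixed point of z |-> gam X - z; the
    division is exact because X has even size.\<close>
  define m where "m x = (-1) ^ x * (gam X div 2 - gamma_upto X x)" for x
  define d where "d x = zag (m x)" for x
  have X: "X \<subseteq> {1..N}" "finite X" "even (card X)" using assms by (auto simp: EN_def finite_subset)
  have "even (gam X)" using even_gam_iff X by simp
  then have "m N = m 0" using gam_eq_upto[OF X(1)] assms(1) by (auto simp: m_def gamma_upto_def elim!: evenE)
  then have 0: "d N = d 0" by (simp add: d_def)
  have m: "m x = - m (x - 1) - of_bool (x \<in> X)" if "1 \<le> x" for x
    using that by (cases x) (simp_all add: m_def gamma_upto_Suc algebra_simps flip: power_add mult_2)
  note st = zag_step[OF m, folded d_def]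
  have "admissible N d" using 0 st by (auto simp: admissible_def)
  moreover have "path_set N d = X" using st X by (auto simp: path_set_def)
  ultimately show thesis by (rule that)
qed

section \<open>Matchings and closed paths\<close>

text \<open>The usual recovery of brackets from their height function: j closes at the first cyclic
  return to the level that the path had just before i.\<close>

definition links :: "nat \<Rightarrow> (nat \<Rightarrow> nat) \<Rightarrow> nat \<Rightarrow> nat \<Rightarrow> bool" where
  "links N d i j \<longleftrightarrow> i \<in> {1..N} \<and> j \<in> {1..N} \<and> i \<noteq> j \<and> d (i - 1) = d j \<and>
     (\<forall>c\<in>gaps N i j. d j < d c)"

lemma links_up: "links N d i j \<Longrightarrow> d (i - 1) < d i"
  by (auto simp: links_def gaps_def)

lemma links_down: "links N d i j \<Longrightarrow> d j < d (j - 1)"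
proof -
  assume l: "links N d i j"
  then have "j - 1 \<in> gaps N i j" by (auto simp: links_def gaps_def)
  then show ?thesis using l by (simp add: links_def)
qed

lemma links_right_unique: "links N d i j \<Longrightarrow> links N d i k \<Longrightarrow> j = k"
proof (rule ccontr)
  assume l: "links N d i j" "links N d i k" and "j \<noteq> k"
  then have "j \<in> gaps N i k \<or> k \<in> gaps N i j"
    by (auto simp: links_def gaps_def)
  then show False using l by (fastforce simp: links_def)
qed

text \<open>Two arcs that do not cross are nested, disjoint, or together cover the circle; the last
  case is excluded by the point v outside both. Hence an arc that passes over the gap just after j
  passes over all of the arc from i to j.\<close>

lemma gaps_nested:
  assumes "i \<in> {1..N}" "j \<in> {1..N}" "k \<in> {1..N}" "l \<in> {1..N}" "v \<in> {1..N}"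
    "i \<noteq> j" "k \<noteq> l" "k \<noteq> i" "k \<noteq> j" "l \<noteq> i" "l \<noteq> j"
    "j \<in> gaps N k l" "c \<in> gaps N i j" "v \<notin> brk N i j" "v \<notin> brk N k l"
    "i \<in> brk N k l \<longleftrightarrow> j \<in> brk N k l" "k \<in> brk N i j \<longleftrightarrow> l \<in> brk N i j"
  shows "c \<in> gaps N k l"
proof -
  have gaps: "x \<in> gaps N a b \<longleftrightarrow> (if a < b then a \<le> x \<and> x < b else (a \<le> x \<and> x \<le> N) \<or> x < b)" for x a b
    by (auto simp: gaps_def)
  have brk: "x \<in> brk N a b \<longleftrightarrow> (if a < b then a \<le> x \<and> x \<le> b else (a \<le> x \<and> x \<le> N) \<or> (1 \<le> x \<and> x \<le> b))" for x a b
    by (auto simp: brk_def)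
  have j: "j \<in> brk N k l" using assms(2,12) by (auto simp: gaps_def brk_def split: if_splits)
  then have "i \<in> brk N k l" using assms(16) by blast
  consider "i < j" "k < l" | "i < j" "l < k" | "j < i" "k < l" | "j < i" "l < k"
    using assms(6,7) by linarith
  then show ?thesis
  proof cases
    case 1
    then show ?thesis using assms j \<open>i \<in> brk N k l\<close> by (simp add: gaps brk)
  next
    case 2
    then show ?thesis using assms j \<open>i \<in> brk N k l\<close> by (simp add: gaps brk) linarith
  next
    case 3
    then show ?thesis using assms j \<open>i \<in> brk N k l\<close> by (simp add: gaps brk) 
  next
    case 4
    then show ?thesis using assms j \<open>i \<in> brk N k l\<close> by (simp add: gaps brk) linarith
  qed
qed

text \<open>Every other arc contains both i and j or neither, so the depths just before i and just
  after j agree. By \<open>gaps_nested\<close> each arc over the gap j also lies over any gap c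
  inside; the arc from i to j itself makes the inequality strict.\<close>

lemma Good_links:
  assumes odd: "odd N" and B: "B \<in> Good N" and ij: "(i, j) \<in> arcs B"
  shows "links N (depth N B) i j"
proof -
  note PN = Good_PN[OF B]
  note ij' = PN_arc[OF PN ij]
  obtain v where v: "1 \<le> v" "v \<le> N" "v \<notin> \<Union>B" using free_point[OF odd PN] by blast
  have fin: "finite (arcs B)" using finite_arcs[OF PN] .
  have other: "fst q \<notin> {i, j} \<and> snd q \<notin> {i, j} \<and> 1 \<le> fst q \<and> fst q \<le> N \<and> 1 \<le> snd q \<and> snd q \<le> N
      \<and> (i \<in> brk N (fst q) (snd q) \<longleftrightarrow> j \<in> brk N (fst q) (snd q))
      \<and> (fst q \<in> brk N i j \<longleftrightarrow> snd q \<in> brk N i j) \<and> v \<notin> brk N (fst q) (snd q)"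
    if q: "q \<in> arcs B" "q \<noteq> (i, j)" for q
  proof -
    have q': "(fst q, snd q) \<in> arcs B" using q by simp
    have "{fst q, snd q} \<inter> {i, j} = {}"
      using arcs_eq[OF PN q' ij] q(2) by (metis disjoint_iff prod.collapse)
    then show ?thesis
      using PN_arc[OF PN q'] Good_brk_iff[OF B q' ij] Good_brk_iff[OF B ij q'] Good_free[OF B q' v(3)]
      by auto
  qed
  have self: "i - 1 \<notin> gaps N i j" "j \<notin> gaps N i j"
    using ij' wr_gt[of i j] by (auto simp: gaps_def)
  have "depth N B (i - 1) = depth N B j"
  proof -
    have "i - 1 \<in> gaps N (fst q) (snd q) \<longleftrightarrow> j \<in> gaps N (fst q) (snd q)" if q: "q \<in> arcs B" for q
    proof (cases "q = (i, j)")
      case True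
      then show ?thesis using self by simp
    next
      case False
      note o = other[OF q False]
      then have "i - 1 \<in> gaps N (fst q) (snd q) \<longleftrightarrow> i \<in> brk N (fst q) (snd q)"
        using gaps_step[of i "fst q" "snd q" N] brk_gaps[of i "fst q" "snd q" N] ij' by blast
      moreover have "j \<in> gaps N (fst q) (snd q) \<longleftrightarrow> j \<in> brk N (fst q) (snd q)"
        using o brk_gaps[of j "fst q" "snd q" N] ij' by blast
      ultimately show ?thesis using o by blast
    qed
    then show ?thesis unfolding depth_def
      by (intro arg_cong[where f = card] Collect_cong) blast
  qed
  moreover have "depth N B j < depth N B c" if c: "c \<in> gaps N i j" for c
    unfolding depth_def
  proof (rule psubset_card_mono)
    show "finite {p \<in> arcs B. c \<in> gaps N (fst p) (snd p)}" using fin by simp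
    have v': "v \<notin> brk N i j" using Good_free[OF B ij v(3)] .
    have "c \<in> gaps N (fst q) (snd q)" if q: "q \<in> arcs B" "j \<in> gaps N (fst q) (snd q)" for q
    proof -
      have ne: "q \<noteq> (i, j)" using q self by auto
      note o = other[OF q(1) ne]
      have "fst q \<noteq> snd q" using PN_arc(5)[OF PN, of "fst q" "snd q"] q(1) by simp
      then show ?thesis using o q(2) c v v' ij'
        by (intro gaps_nested[of i N j "fst q" "snd q" v c]) auto
    qed
    moreover have "(i, j) \<in> {p \<in> arcs B. c \<in> gaps N (fst p) (snd p)}" using ij c by simp
    moreover have "(i, j) \<notin> {p \<in> arcs B. j \<in> gaps N (fst p) (snd p)}" using self by simp
    ultimately show "{p \<in> arcs B. j \<in> gaps N (fst p) (snd p)} \<subset> {p \<in> arcs B. c \<in> gaps N (fst p) (snd p)}"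
      by blast
  qed
  ultimately show ?thesis using ij' by (auto simp: links_def)
qed

text \<open>Conversely, a link from i makes the step at i go up, so i is matched and written first
  in its pair. That pair is also a link from i, and first returns are unique.\<close>

lemma Good_eq_links:
  assumes odd: "odd N" and B: "B \<in> Good N"
  shows "B = {{i, j} | i j. links N (depth N B) i j}"
proof (intro equalityI subsetI)
  fix P assume "P \<in> B"
  then obtain i j where "(i, j) \<in> arcs B" "P = {i, j}" by (rule PN_pair[OF Good_PN[OF B]])
  then show "P \<in> {{i, j} | i j. links N (depth N B) i j}" using Good_links[OF odd B] by blast
next
  fix P assume "P \<in> {{i, j} | i j. links N (depth N B) i j}"
  then obtain i j where P: "P = {i, j}" and l: "links N (depth N B) i j" by blast
  have i: "1 \<le> i" "i \<le> N" using l by (auto simp: links_def)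
  note up = links_up[OF l] and PN = Good_PN[OF B]
  have "i \<in> \<Union>B" using Good_depth_free[OF B i] up by fastforce
  moreover have False if "(y, i) \<in> arcs B" for y
    using depth_cases(2)[OF PN i that] up by simp
  ultimately obtain k where k: "(i, k) \<in> arcs B" using in_Union_arcs[OF PN] by metis
  then have "j = k" using links_right_unique[OF l] Good_links[OF odd B k] by blast
  then show "P \<in> B" using k P by (simp add: arcs_def)
qed

lemma wsum_inj:
  assumes "odd N" "B \<in> Good N" "C \<in> Good N" "wsum N B = wsum N C"
  shows "B = C"
proof -
  have eq: "depth N B x = depth N C x" if "x \<le> N" for x
    using path_set_inj[OF assms(1) Good_admissible(1)[OF assms(2)] Good_admissible(1)[OF assms(3)] _ that]
      Good_admissible(2)[OF assms(2)] Good_admissible(2)[OF assms(3)] assms(4) by simp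
  have "links N (depth N B) i j \<longleftrightarrow> links N (depth N C) i j" for i j
  proof (cases "i \<in> {1..N} \<and> j \<in> {1..N}")
    case True
    then have "depth N B c = depth N C c" if "c \<in> gaps N i j \<union> {i - 1, j}" for c
      using that eq by (auto simp: gaps_def split: if_splits)
    then show ?thesis by (simp add: links_def)
  qed (auto simp: links_def)
  then show ?thesis using Good_eq_links[OF assms(1,2)] Good_eq_links[OF assms(1,3)] by simp
qed

text \<open>The arcs over the gap between N and 1 are those with j < i, which \<open>wr\<close>
  reserves for even differences.\<close>

lemma depth_eq_0: 
  assumes "B \<in> PN N" shows "depth N B 0 = card (Bzero B)"
proof -
  have "bij_betw (\<lambda>p. {fst p, snd p}) {p \<in> arcs B. 0 \<in> gaps N (fst p) (snd p)} (Bzero B)"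
    unfolding bij_betw_def
  proof
    show "inj_on (\<lambda>p. {fst p, snd p}) {p \<in> arcs B. 0 \<in> gaps N (fst p) (snd p)}"
      by (rule inj_onI) (auto simp: arcs_def doubleton_eq_iff dest: wr_antisym)
    show "(\<lambda>p. {fst p, snd p}) ` {p \<in> arcs B. 0 \<in> gaps N (fst p) (snd p)} = Bzero B"
    proof (intro equalityI subsetI)
      fix P assume "P \<in> (\<lambda>p. {fst p, snd p}) ` {p \<in> arcs B. 0 \<in> gaps N (fst p) (snd p)}"
      then obtain i j where ij: "(i, j) \<in> arcs B" "0 \<in> gaps N i j" "P = {i, j}" by auto
      then have "j < i" "even (i - j)" "{i, j} \<in> B"
        using PN_arc[OF assms ij(1)] by (auto simp: gaps_def wr_def split: if_splits)
      then have "even (int i - int j)" by (metis even_of_nat_iff less_or_eq_imp_le of_nat_diff)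
      then show "P \<in> Bzero B" using ij \<open>j < i\<close> \<open>{i, j} \<in> B\<close> unfolding Bzero_def by blast
    next
      fix P assume "P \<in> Bzero B"
      then obtain a b where P: "P \<in> B" "P = {a, b}" "a \<noteq> b" "even (int a - int b)" by (auto simp: Bzero_def)
      obtain i j where ij: "(i, j) \<in> arcs B" "P = {i, j}" by (rule PN_pair[OF assms P(1)])
      have "even (int i - int j)" using P ij by (auto simp: doubleton_eq_iff)
      then have "j < i" using ij by (auto simp: arcs_def wr_def)
      then have "0 \<in> gaps N i j" using PN_arc[OF assms ij(1)] by (simp add: gaps_def)
      then show "P \<in> (\<lambda>p. {fst p, snd p}) ` {p \<in> arcs B. 0 \<in> gaps N (fst p) (snd p)}" using ij by force
    qed
  qed
  then show ?thesis unfolding depth_def by (rule bij_betw_same_card)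
qed

lemma Good_gam:
  assumes "odd N" "B \<in> Good N"
  shows "gam (wsum N B) = 2 * zig (card (Bzero B))"
  using gam_path_set[OF assms(1) Good_admissible(1)[OF assms(2)]] Good_admissible(2)[OF assms(2)]
    depth_eq_0[OF Good_PN[OF assms(2)]] by simp

lemma Good_wsum_EN:
  assumes "odd N" "B \<in> Good N"
  shows "wsum N B \<in> EN N"
proof -
  have "wsum N B \<subseteq> {1..N}" using wsum_subset[OF Good_PN[OF assms(2)]] .
  then show ?thesis using even_gam_iff[of "wsum N B"] Good_gam[OF assms]
    by (auto simp: EN_def finite_subset)
qed

text \<open>Off the flat steps the height changes by one each time, so d x + x keeps its
  parity.\<close>

lemma path_parity:
  assumes "admissible N d" "b \<le> N" "a \<le> b" "\<And>x. a < x \<Longrightarrow> x \<le> b \<Longrightarrow> d x \<noteq> 0 \<or> d (x - 1) \<noteq> 0"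
  shows "even (d a + d b + a + b)"
  using assms(3,2,4)
proof (induction b rule: dec_induct)
  case (step b)
  have "d (Suc b) = Suc (d b) \<or> d b = Suc (d (Suc b)) \<or> (d (Suc b) = 0 \<and> d b = 0)"
    using assms(1) step.prems(1) by (auto simp: admissible_def dest: bspec[of _ _ "Suc b"])
  moreover have "d (Suc b) \<noteq> 0 \<or> d b \<noteq> 0" using step.prems(2)[of "Suc b"] step.hyps by simp
  moreover have "even (d a + d b + a + b)" using step by simp
  ultimately show ?case by (elim disjE) (auto simp: even_add)
qed simp

section \<open>From a closed path back to a good matching\<close>

context
  fixes N :: nat and d :: "nat \<Rightarrow> nat"
  assumes odd: "odd N" and adm: "admissible N d"
begin

lemma adm_step:
  assumes "1 \<le> x" "x \<le> N"
  shows "d x = Suc (d (x - 1)) \<or> d (x - 1) = Suc (d x) \<or> (d x = 0 \<and> d (x - 1) = 0)"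
  using adm assms by (auto simp: admissible_def)

lemma adm_ends: "d N = d 0"
  using adm by (simp add: admissible_def)

text \<open>A closed path with an odd number of steps cannot consist of steps +1 and -1 only; it has
  a flat step, which lies at height 0.\<close>

lemma adm_zero: obtains z where "z \<le> N" "d z = 0"
proof -
  have "\<exists>x\<in>{1..N}. d x = 0"
  proof (rule ccontr)
    assume "\<not> (\<exists>x\<in>{1..N}. d x = 0)"
    then have "even (d 0 + d N + 0 + N)" by (intro path_parity[OF adm]) auto
    then show False using odd adm_ends by simp
  qed
  then show thesis using that by auto
qed

text \<open>Inside a link the path stays above a level, so there is no flat step and the arc has an
  even number of points. When the arc passes N, the count is made separately before and after the
  gap labelled both N and 0.\<close>

lemma links_wr:
  assumes "links N d i j"
  shows "wr i j"
proof (cases "i < j")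
  case True
  have "even (d (i - 1) + d j + (i - 1) + j)"
  proof (rule path_parity[OF adm])
    fix x assume "i - 1 < x" "x \<le> j"
    then have "x - 1 \<in> gaps N i j \<or> x \<in> gaps N i j"
      using True by (auto simp: gaps_def)
    then show "d x \<noteq> 0 \<or> d (x - 1) \<noteq> 0" using assms by (force simp: links_def)
  qed (use assms True in \<open>auto simp: links_def\<close>)
  then have "even (i - 1 + j)" "1 \<le> i" using assms by (auto simp: links_def)
  then show ?thesis using True by (auto simp: wr_def)
next
  case False
  have ij: "j < i" "1 \<le> i" "i \<le> N" "1 \<le> j" using assms False by (auto simp: links_def)
  have "even (d (i - 1) + d N + (i - 1) + N)"
  proof (rule path_parity[OF adm])
    fix x assume "i - 1 < x" "x \<le> N"
    then have "x \<in> gaps N i j" using ij by (auto simp: gaps_def)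
    then show "d x \<noteq> 0 \<or> d (x - 1) \<noteq> 0" using assms by (force simp: links_def)
  qed (use ij in auto)
  moreover have "even (d 0 + d j + 0 + j)"
  proof (rule path_parity[OF adm])
    fix x assume "0 < x" "x \<le> j"
    then have "x - 1 \<in> gaps N i j" using ij by (auto simp: gaps_def)
    then show "d x \<noteq> 0 \<or> d (x - 1) \<noteq> 0" using assms by (force simp: links_def)
  qed (use ij in auto)
  ultimately have "even ((d (i - 1) + d N + (i - 1) + N) + (d 0 + d j + 0 + j))" by (rule dvd_add)
  \<comment> \<open>The heights pair off because d (i - 1) = d j and d N = d 0; odd N then turns the
    parity of i - 1 + N + j into that of i + j.\<close>
  moreover have "\<dots> = 2 * (d j + d 0) + (i - 1 + N + j)"
    using assms adm_ends by (simp add: links_def)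
  ultimately have "even (i - 1 + N + j)" by (metis dvd_add_times_triv_left_iff mult.commute)
  then have "even (i + j)" using odd ij by (cases i) (auto simp: even_add)
  then show ?thesis using ij by (auto simp: wr_def)
qed

lemma up_links:
  assumes x: "1 \<le> x" "x \<le> N" "d x = Suc (d (x - 1))"
  obtains y where "links N d x y"
proof (cases "\<exists>y. x < y \<and> y \<le> N \<and> d y < d x")
  case True
  define y where "y = (LEAST y. x < y \<and> y \<le> N \<and> d y < d x)"
  have y: "x < y" "y \<le> N" "d y < d x" using LeastI_ex[OF True] by (auto simp: y_def)
  have min: "d x \<le> d c" if "x \<le> c" "c < y" for c
    using not_less_Least[of c "\<lambda>y. x < y \<and> y \<le> N \<and> d y < d x"] that y
    by (cases "c = x") (auto simp: y_def[symmetric])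
  have "d x \<le> d (y - 1)" using min[of "y - 1"] y by simp
  then have "d y = d (x - 1)" using adm_step[of y] y x by auto
  moreover have "d (x - 1) < d c" if "x \<le> c" "c < y" for c using min[OF that] x by simp
  ultimately have "links N d x y" using x y by (simp add: links_def gaps_def)
  then show thesis by (rule that)
next
  \<comment> \<open>No gap from x up to N is lower than d x, so the search continues from gap 0 and
    succeeds at x - 1 at the latest. It does not stop at 0, because gap 0 is gap N.\<close>
  case False
  then have hi: "d x \<le> d c" if "x \<le> c" "c \<le> N" for c using that by (cases "c = x") (auto simp: not_less)
  have ex: "\<exists>y. d y < d x" using x by (metis lessI)
  define y where "y = (LEAST y. d y < d x)"
  have y: "d y < d x" using LeastI_ex[OF ex] by (auto simp: y_def)
  have min: "d x \<le> d c" if "c < y" for c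
    using not_less_Least[of c "\<lambda>y. d y < d x"] that by (auto simp: y_def[symmetric])
  have "y \<le> x - 1" unfolding y_def by (rule Least_le) (use x in simp)
  moreover have "y \<noteq> 0" using y hi[of N] adm_ends x by (metis less_le_not_le order_refl)
  ultimately have yx: "1 \<le> y" "y < x" using x by auto
  have "d x \<le> d (y - 1)" using min[of "y - 1"] yx by simp
  then have "d y = d (x - 1)" using adm_step[of y] y x yx by auto
  moreover have "d (x - 1) < d c" if "x \<le> c \<and> c \<le> N \<or> c < y" for c
    using min[of c] hi[of c] that x by auto
  ultimately have "links N d x y" using x yx by (auto simp: links_def gaps_def)
  then show thesis by (rule that)
qed

text \<open>The mirror image of \<open>up_links\<close>: a backward search for the last lower gap p.
  The gap p precedes the point p + 1, so the link starts at \<open>Suc p\<close>.\<close>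

lemma down_links:
  assumes x: "1 \<le> x" "x \<le> N" "d (x - 1) = Suc (d x)"
  obtains y where "links N d y x"
proof (cases "\<exists>p. p < x \<and> d p < d (x - 1)")
  case True
  define p where "p = (GREATEST p. p < x \<and> d p < d (x - 1))"
  have p: "p < x" "d p < d (x - 1)"
    using GreatestI_ex_nat[OF True, of x] by (auto simp: p_def)
  have max: "d (x - 1) \<le> d c" if "p < c" "c < x" for c
  proof (rule ccontr)
    assume "\<not> ?thesis"
    then have "c \<le> p" unfolding p_def by (intro Greatest_le_nat[where b = x]) (use that in auto)
    then show False using that by simp
  qed
  have "p \<noteq> x - 1" using p by auto
  then have px: "Suc p < x" using p by simp
  have "d p = d x" using adm_step[of "Suc p"] max[of "Suc p"] px p x by auto
  moreover have "d x < d c" if "Suc p \<le> c" "c < x" for c using max[of c] that x by simp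
  ultimately have "links N d (Suc p) x" using px x by (simp add: links_def gaps_def)
  then show thesis by (rule that)
next
  case False
  then have lo: "d (x - 1) \<le> d c" if "c < x" for c using that not_le by blast
  have ex: "\<exists>p. p \<le> N \<and> d p < d (x - 1)" using x by (metis lessI)
  define p where "p = (GREATEST p. p \<le> N \<and> d p < d (x - 1))"
  have p: "p \<le> N" "d p < d (x - 1)"
    using GreatestI_ex_nat[OF ex, of N] by (auto simp: p_def)
  have max: "d (x - 1) \<le> d c" if "p < c" "c \<le> N" for c
  proof (rule ccontr)
    assume "\<not> ?thesis"
    then have "c \<le> p" unfolding p_def by (intro Greatest_le_nat[where b = N]) (use that in auto)
    then show False using that by simp
  qed
  have "x \<le> p" unfolding p_def by (rule Greatest_le_nat[where b = N]) (use x in auto)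
  moreover have "p \<noteq> N" using p lo[of 0] adm_ends x by auto
  ultimately have px: "x \<le> p" "p < N" using p by auto
  have "d p = d x" using adm_step[of "Suc p"] max[of "Suc p"] px p x by auto
  moreover have "d x < d c" if "Suc p \<le> c \<and> c \<le> N \<or> c < x" for c
    using max[of c] lo[of c] that x by auto
  ultimately have "links N d (Suc p) x" using px x by (auto simp: links_def gaps_def)
  then show thesis by (rule that)
qed

lemma links_left_unique:
  assumes "links N d i j" "links N d k j"
  shows "i = k"
proof (rule ccontr)
  assume "i \<noteq> k"
  have l: "1 \<le> i" "i \<le> N" "1 \<le> k" "k \<le> N" "d (i - 1) = d j" "d (k - 1) = d j"
    "\<forall>c\<in>gaps N i j. d j < d c" "\<forall>c\<in>gaps N k j. d j < d c" "i \<noteq> j" "k \<noteq> j" "1 \<le> j"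
    using assms by (auto simp: links_def)
  have "i - 1 \<in> gaps N k j \<or> k - 1 \<in> gaps N i j"
    using \<open>i \<noteq> k\<close> l(1-4,9-11) by (auto simp: gaps_def)
  then show False using l by fastforce
qed

text \<open>A point cannot open one link and close another, since the path would go both up and down
  there.\<close>

lemma links_meet:
  assumes "links N d i j" "links N d k l" "x \<in> {i, j}" "x \<in> {k, l}"
  shows "i = k \<and> j = l"
proof -
  have "i \<noteq> l" "k \<noteq> j"
    using links_up[OF assms(1)] links_down[OF assms(2)] links_up[OF assms(2)] links_down[OF assms(1)]
    by auto
  then have "i = k \<or> j = l" using assms(3,4) by auto
  then show ?thesis
    using links_right_unique links_left_unique assms(1,2) by metis
qed

definition path_pairs :: "nat set set" where
  "path_pairs = {{i, j} | i j. links N d i j}"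

lemma path_pairs_PN: "path_pairs \<in> PN N"
proof -
  have "path_pairs \<subseteq> Pow {1..N}" by (auto simp: path_pairs_def links_def)
  moreover have "card P = 2" if "P \<in> path_pairs" for P
    using that by (auto simp: path_pairs_def links_def)
  moreover have "P = Q" if "P \<in> path_pairs" "Q \<in> path_pairs" "x \<in> P" "x \<in> Q" for P Q x
    using that links_meet unfolding path_pairs_def by (smt (verit) mem_Collect_eq)
  then have "pairwise disjnt path_pairs" unfolding pairwise_def disjnt_iff by blast
  ultimately show ?thesis
    by (auto simp: PN_def intro: finite_subset)
qed

lemma arcs_path_pairs: "(i, j) \<in> arcs path_pairs \<longleftrightarrow> links N d i j"
proof
  assume "(i, j) \<in> arcs path_pairs"
  then obtain k l where "links N d k l" "{i, j} = {k, l}" "wr i j"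
    by (auto simp: arcs_def path_pairs_def)
  then show "links N d i j" using links_wr wr_antisym by (auto simp: doubleton_eq_iff)
qed (use links_wr in \<open>auto simp: arcs_def path_pairs_def\<close>)

text \<open>At a point x strictly inside an arc from i to j the path is above d j, so x is an end of
  some link. If its partner lay outside, that link would pass over the gap j or the gap i - 1, whose
  height is too low for it.\<close>

lemma path_pairs_Good: "path_pairs \<in> Good N"
proof -
  have "\<exists>P\<in>path_pairs. x \<in> P \<and> P \<subseteq> brk N i j" if ij: "links N d i j" and x: "x \<in> brk N i j" for i j x
  proof (cases "x \<in> {i, j}")
    case True
    have "{i, j} \<subseteq> brk N i j" using ij by (auto simp: brk_def links_def)
    then show ?thesis using ij True unfolding path_pairs_def by blast
  next
    case False
    have l: "1 \<le> i" "i \<le> N" "1 \<le> j" "j \<le> N" "i \<noteq> j" "d (i - 1) = d j" "\<And>c. c \<in> gaps N i j \<Longrightarrow> d j < d c"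
      using ij by (auto simp: links_def)
    have xN: "1 \<le> x" "x \<le> N" using x l by (auto simp: brk_def split: if_splits)
    have g: "x \<in> gaps N i j" "x - 1 \<in> gaps N i j"
      using brk_gaps[of x i j N] gaps_step[of x i j N] False x xN by auto
    from l(7)[OF g(1)] adm_step[OF xN] consider "d x = Suc (d (x - 1))" | "d (x - 1) = Suc (d x)" by force
    then show ?thesis
    proof cases
      case 1
      then obtain y where y: "links N d x y" using up_links xN by blast
      have "y \<in> brk N i j"
      proof (rule ccontr)
        assume "y \<notin> brk N i j"
        then have "j \<in> gaps N x y"
          using y x False l(1-5) xN by (auto simp: brk_def gaps_def links_def split: if_splits)
        then have "d (x - 1) < d j" using y by (auto simp: links_def)
        then show False using l(7)[OF g(2)] by simp
      qed
      then show ?thesis using y x by (auto simp: path_pairs_def)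
    next
      case 2
      then obtain y where y: "links N d y x" using down_links xN by blast
      have "y \<in> brk N i j"
      proof (rule ccontr)
        assume "y \<notin> brk N i j"
        then have "i - 1 \<in> gaps N y x"
          using y x False l(1-5) xN by (auto simp: brk_def gaps_def links_def split: if_splits)
        then have "d x < d (i - 1)" using y by (auto simp: links_def)
        then show False using l(6) l(7)[OF g(1)] by simp
      qed
      then show ?thesis using y x by (auto simp: path_pairs_def)
    qed
  qed
  then show ?thesis using path_pairs_PN by (auto simp: Good_def arcs_path_pairs saturated_def)
qed

text \<open>Depth and height change by the same amount at every point, so they differ by a constant.
  No link passes over a gap of height 0, so there both vanish.\<close>

lemma depth_path_pairs:
  assumes "x \<le> N"
  shows "depth N path_pairs x = d x"
proof -
  let ?D = "\<lambda>x. int (depth N path_pairs x) - int (d x)"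
  have step: "?D x = ?D (x - 1)" if x: "1 \<le> x" "x \<le> N" for x
    using adm_step[OF x]
  proof (elim disjE)
    assume up: "d x = Suc (d (x - 1))"
    then obtain y where "(x, y) \<in> arcs path_pairs" using up_links x arcs_path_pairs by metis
    then show ?thesis using depth_cases(1)[OF path_pairs_PN x] up by simp
  next
    assume down: "d (x - 1) = Suc (d x)"
    then obtain y where "(y, x) \<in> arcs path_pairs" using down_links x arcs_path_pairs by metis
    then show ?thesis using depth_cases(2)[OF path_pairs_PN x] down by simp
  next
    assume flat: "d x = 0 \<and> d (x - 1) = 0"
    have "x \<notin> \<Union>path_pairs"
    proof
      assume "x \<in> \<Union>path_pairs"
      then obtain y where "links N d x y \<or> links N d y x" by (auto simp: path_pairs_def)
      then show False using flat links_up[of N d x y] links_down[of N d y x] by auto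
    qed
    then show ?thesis using depth_cases(3)[OF path_pairs_PN x] flat by simp
  qed
  have const: "?D x = ?D 0" if "x \<le> N" for x
    using that by (induction x) (use step in force)+
  obtain z where z: "z \<le> N" "d z = 0" by (rule adm_zero)
  have "{p \<in> arcs path_pairs. z \<in> gaps N (fst p) (snd p)} = {}"
    using z(2) by (auto simp: arcs_path_pairs links_def)
  then have "depth N path_pairs z = 0" unfolding depth_def by (metis card.empty)
  then have "?D z = 0" using z by simp
  then show ?thesis using const[OF z(1)] const[OF assms] by simp
qed

lemma wsum_path_pairs: "wsum N path_pairs = path_set N d"
  using Good_admissible(2)[OF path_pairs_Good] depth_path_pairs by (auto simp: path_set_def)

end

lemma wsum_bij:
  assumes "odd N"
  shows "bij_betw (wsum N) (Good N) (EN N)"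
proof (rule bij_betwI')
  show "\<exists>B\<in>Good N. X = wsum N B" if "X \<in> EN N" for X
    using path_exists[OF assms that] wsum_path_pairs[OF assms] path_pairs_Good[OF assms] by metis
qed (use wsum_inj[OF assms] Good_wsum_EN[OF assms] in auto)

section \<open>Coverings\<close>

text \<open>Two blocks through a common point coincide, so a block inside S that meets T is one of
  the blocks making up T; the remaining ones avoid T.\<close>

lemma saturated_diff:
  assumes "B \<in> PN N" "A \<subseteq> B" "saturated A S" "saturated A T"
  shows "saturated A (S - T)"
  unfolding saturated_def
proof
  fix x assume x: "x \<in> S - T"
  then obtain P where P: "P \<in> A" "x \<in> P" "P \<subseteq> S" using assms(3) by (auto simp: saturated_def)
  have False if y: "y \<in> P" "y \<in> T" for y
  proof -
    obtain Q where Q: "Q \<in> A" "y \<in> Q" "Q \<subseteq> T" using assms(4) y(2) unfolding saturated_def by blast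
    then have "P = Q" using PN_disjoint[OF assms(1) _ _ y(1) Q(2)] P(1) assms(2) by blast
    then show False using P(2) Q(3) x by blast
  qed
  then show "\<exists>P\<in>A. x \<in> P \<and> P \<subseteq> S - T" using P by blast
qed

lemma saturated_Un: "saturated A S \<Longrightarrow> saturated A T \<Longrightarrow> saturated A (S \<union> T)"
  unfolding saturated_def by (metis Un_iff le_supI1 le_supI2)

lemma saturated_mono: "saturated A S \<Longrightarrow> A \<subseteq> A' \<Longrightarrow> saturated A' S"
  unfolding saturated_def by (meson subsetD)

lemma saturated_block: "P \<in> A \<Longrightarrow> saturated A P"
  unfolding saturated_def by blast

lemma even_card_saturated':
  assumes "B \<in> PN N" "A \<subseteq> B" "saturated A S"
  shows "even (card S)"
  using even_card_saturated[OF assms(1) saturated_mono[OF assms(3,2)]] .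

lemma B1pairs_iff: "(a, b) \<in> B1pairs B \<longleftrightarrow> (a, b) \<in> arcs B \<and> a < b"
proof -
  have "{a, b} \<in> Bone B \<longleftrightarrow> {a, b} \<in> B \<and> a \<noteq> b \<and> odd (int a - int b)"
  proof
    assume "{a, b} \<in> Bone B"
    then obtain x y where "{a, b} \<in> B" "{a, b} = {x, y}" "x \<noteq> y" "odd (int x - int y)"
      unfolding Bone_def by blast
    then show "{a, b} \<in> B \<and> a \<noteq> b \<and> odd (int a - int b)"
      by (auto simp: doubleton_eq_iff insert_commute)
  qed (unfold Bone_def, blast)
  moreover have "odd (int a - int b) \<longleftrightarrow> odd (a + b)" by simp
  ultimately show ?thesis by (auto simp: B1pairs_def arcs_def wr_def)
qed

lemma Bone_pair:
  assumes "B \<in> PN N" "P \<in> Bone B"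
  obtains a b where "(a, b) \<in> arcs B" "a < b" "P = {a, b}"
proof -
  have P: "P \<in> B" using assms(2) by (simp add: Bone_def)
  obtain i j where ij: "(i, j) \<in> arcs B" "P = {i, j}" by (rule PN_pair[OF assms(1) P])
  have "odd (int i - int j)" using assms(2) ij(2) by (auto simp: Bone_def doubleton_eq_iff)
  then have "i < j" using ij(1) by (auto simp: arcs_def wr_def)
  then show thesis using that ij by blast
qed

lemma Bzero_pair:
  assumes "B \<in> PN N" "P \<in> Bzero B"
  obtains a b where "(a, b) \<in> arcs B" "b < a" "P = {a, b}"
proof -
  have P: "P \<in> B" using assms(2) by (simp add: Bzero_def)
  obtain i j where ij: "(i, j) \<in> arcs B" "P = {i, j}" by (rule PN_pair[OF assms(1) P])
  have "even (int i - int j)" using assms(2) ij(2) by (auto simp: Bzero_def doubleton_eq_iff)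
  then have "j < i" using ij(1) by (auto simp: arcs_def wr_def)
  then show thesis using that ij by blast
qed

lemma arc_Bone: "(a, b) \<in> arcs B \<Longrightarrow> a < b \<Longrightarrow> {a, b} \<in> Bone B"
  using B1pairs_iff[of a b B] by (simp add: B1pairs_def)

lemma arc_Bzero:
  assumes "(a, b) \<in> arcs B" "b < a"
  shows "{a, b} \<in> Bzero B"
proof -
  have "even (a - b)" "{a, b} \<in> B" using assms by (auto simp: arcs_def wr_def)
  then have "even (int a - int b)" using assms(2) by simp
  then show ?thesis using assms(2) \<open>{a, b} \<in> B\<close> unfolding Bzero_def by blast
qed

lemma Bone_subset: "Bone B \<subseteq> B" and Bzero_subset: "Bzero B \<subseteq> B"
  by (auto simp: Bone_def Bzero_def)

lemma Bone_or_Bzero: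
  assumes "B \<in> PN N" "P \<in> B"
  shows "P \<in> Bone B \<or> P \<in> Bzero B"
proof -
  obtain i j where ij: "(i, j) \<in> arcs B" "P = {i, j}" by (rule PN_pair[OF assms])
  then show ?thesis using PN_arc(5)[OF assms(1) ij(1)] arc_Bone arc_Bzero by (metis linorder_neqE_nat)
qed

lemma Bone_Bzero_disjoint:
  assumes "B \<in> PN N" "x \<in> P" "P \<in> Bone B" "x \<in> Q" "Q \<in> Bzero B"
  shows False
proof -
  have "P = Q" using PN_disjoint[OF assms(1) _ _ assms(2,4)] assms(3,5) Bone_subset Bzero_subset by blast
  then show False using Bone_pair[OF assms(1,3)] Bzero_pair[OF assms(1,5)]
    by (metis arcs_eq[OF assms(1)] insertI1 less_asym)
qed

text \<open>The covering condition on B^1 in a form without recursion; \<open>filled_iff\<close>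
  proves the equivalence.\<close>

definition filled :: "nat set set \<Rightarrow> bool" where
  "filled B \<longleftrightarrow> (\<forall>a b. (a, b) \<in> arcs B \<longrightarrow> a < b \<longrightarrow> saturated (Bone B) {a..b})"

lemma cov0_saturated:
  assumes "cov0 B X" "\<And>a b. (a, b) \<in> arcs B \<Longrightarrow> a < b \<Longrightarrow> {a..b} \<subseteq> X \<Longrightarrow> saturated (Bone B) {a..b}"
  shows "saturated (Bone B) X"
  unfolding saturated_def
proof
  fix x assume "x \<in> X"
  then obtain C p where C: "C \<subseteq> B1pairs B" "X = (\<Union>p\<in>C. {fst p..snd p})" "p \<in> C" "x \<in> {fst p..snd p}"
    using assms(1) unfolding cov0_def by blast
  have "(fst p, snd p) \<in> B1pairs B" using C by auto
  moreover have "{fst p..snd p} \<subseteq> X" using C(2,3) by blast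
  ultimately have "saturated (Bone B) {fst p..snd p}"
    using assms(2)[of "fst p" "snd p"] B1pairs_iff[of "fst p" "snd p"] by blast
  then obtain P where "P \<in> Bone B" "x \<in> P" "P \<subseteq> {fst p..snd p}"
    using C(4) unfolding saturated_def by blast
  then show "\<exists>P\<in>Bone B. x \<in> P \<and> P \<subseteq> X" using C(2,3) by blast
qed

text \<open>The leftmost point p can only be the left end of its block, say {p, b}. The interval
  [p, b] is itself a union of blocks, so it can be split off and the rest treated in the same
  way.\<close>

lemma saturated_cov0:
  assumes PN: "B \<in> PN N" and filled: "filled B"
  shows "saturated (Bone B) {p..q} \<Longrightarrow> cov0 B {p..q}"
proof (induction "Suc q - p" arbitrary: p rule: less_induct)
  case (less p)
  show ?case
  proof (cases "p \<le> q")
    case False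
    then show ?thesis unfolding cov0_def by (intro exI[of _ "{}"]) auto
  next
    case True
    then obtain P where P: "P \<in> Bone B" "p \<in> P" "P \<subseteq> {p..q}"
      using less.prems unfolding saturated_def by (meson atLeastAtMost_iff order_refl)
    obtain a b where ab: "(a, b) \<in> arcs B" "a < b" "P = {a, b}" by (rule Bone_pair[OF PN P(1)])
    have "a = p" "b \<le> q" using P ab by auto
    then have pb: "(p, b) \<in> arcs B" "p < b" "b \<le> q" using ab by auto
    have "saturated (Bone B) ({p..q} - {p..b})"
      using filled pb by (intro saturated_diff[OF PN Bone_subset less.prems]) (auto simp: filled_def)
    moreover have "{p..q} - {p..b} = {Suc b..q}" using pb by auto
    ultimately have "cov0 B {Suc b..q}" using less.hyps[of "Suc b"] pb by simp
    then obtain C where C: "finite C" "C \<subseteq> B1pairs B"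
      "\<forall>p\<in>C. \<forall>q\<in>C. p \<noteq> q \<longrightarrow> disjnt {fst p..snd p} {fst q..snd q}"
      "{Suc b..q} = (\<Union>p\<in>C. {fst p..snd p})"
      unfolding cov0_def by blast
    have dis: "disjnt {fst r..snd r} {p..b}" if "r \<in> C" for r
    proof -
      have "{fst r..snd r} \<subseteq> {Suc b..q}" using C(4) that by blast
      then show ?thesis by (auto simp: disjnt_iff subset_iff)
    qed
    have un: "{p..q} = {p..b} \<union> {Suc b..q}" using pb by auto
    show ?thesis unfolding cov0_def
    proof (intro exI[of _ "insert (p, b) C"] conjI)
      show "insert (p, b) C \<subseteq> B1pairs B" using C(2) pb by (simp add: B1pairs_iff)
      show "\<forall>r\<in>insert (p, b) C. \<forall>t\<in>insert (p, b) C. r \<noteq> t \<longrightarrow> disjnt {fst r..snd r} {fst t..snd t}"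
        using C(3) dis by (auto simp: disjnt_sym)
      show "{p..q} = (\<Union>r\<in>insert (p, b) C. {fst r..snd r})" using un C(4) by simp
    qed (use C(1) in simp)
  qed
qed

text \<open>Passing between [i, j] and [i + 1, j - 1] removes or adds the block {i, j}. From the
  covering side, induction on j - i applies because every interval covering the interior is
  shorter.\<close>

lemma filled_iff:
  assumes PN: "B \<in> PN N"
  shows "filled B \<longleftrightarrow> (\<forall>i j. (i, j) \<in> B1pairs B \<longrightarrow> cov0 B {i+1..j-1})"
proof
  assume filled: "filled B"
  show "\<forall>i j. (i, j) \<in> B1pairs B \<longrightarrow> cov0 B {i+1..j-1}"
  proof (intro allI impI)
    fix i j assume "(i, j) \<in> B1pairs B"
    then have ij: "(i, j) \<in> arcs B" "i < j" by (auto simp: B1pairs_iff)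
    have "saturated (Bone B) {i..j}" using filled ij by (simp add: filled_def)
    then have "saturated (Bone B) ({i..j} - {i, j})"
      using saturated_diff[OF PN Bone_subset _ saturated_block[OF arc_Bone[OF ij]]] by blast
    moreover have "{i..j} - {i, j} = {i+1..j-1}" by auto
    ultimately show "cov0 B {i+1..j-1}" using saturated_cov0[OF PN filled] by simp
  qed
next
  assume cov: "\<forall>i j. (i, j) \<in> B1pairs B \<longrightarrow> cov0 B {i+1..j-1}"
  have "saturated (Bone B) {i..j}" if "(i, j) \<in> arcs B" "i < j" for i j
    using that
  proof (induction "j - i" arbitrary: i j rule: less_induct)
    case (less i j)
    have "saturated (Bone B) {i+1..j-1}"
    proof (rule cov0_saturated)
      show "cov0 B {i+1..j-1}" using cov less.prems by (simp add: B1pairs_iff)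
      show "saturated (Bone B) {a..b}" if "(a, b) \<in> arcs B" "a < b" "{a..b} \<subseteq> {i+1..j-1}" for a b
      proof (rule less.hyps[OF _ that(1,2)])
        have "i < a" "b < j" using that(2,3) by auto
        then show "b - a < j - i" using that(2) by linarith
      qed
    qed
    then have "saturated (Bone B) ({i+1..j-1} \<union> {i, j})"
      by (rule saturated_Un) (rule saturated_block[OF arc_Bone[OF less.prems]])
    moreover have "{i+1..j-1} \<union> {i, j} = {i..j}" using less.prems by auto
    ultimately show ?case by simp
  qed
  then show "filled B" by (simp add: filled_def)
qed

lemma cov0_iff:
  assumes "B \<in> PN N" "filled B"
  shows "cov0 B {p..q} \<longleftrightarrow> saturated (Bone B) {p..q}"
  using saturated_cov0[OF assms] cov0_saturated assms(2) unfolding filled_def by blast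

text \<open>Each covering interval avoids u and so lies on one side of it; the covering splits at u,
  and conversely two coverings can be put together. With p at least 1 the bound u - 1 is not
  truncated, so [p, u - 1] really omits u.\<close>

lemma cov1_iff:
  assumes PN: "B \<in> PN N" and filled: "filled B" and p: "1 \<le> p"
  shows "cov1 B {p..q} \<longleftrightarrow>
    (\<exists>u\<in>{p..q}. saturated (Bone B) {p..u-1} \<and> saturated (Bone B) {u+1..q})"
proof
  assume "cov1 B {p..q}"
  then obtain C u where C: "C \<subseteq> B1pairs B" "u \<notin> (\<Union>p\<in>C. {fst p..snd p})"
    "{p..q} = (\<Union>p\<in>C. {fst p..snd p}) \<union> {u}"
    unfolding cov1_def by (elim exE conjE) (rule that; assumption)
  have u: "u \<in> {p..q}" using C(3) by blast
  have *: "\<exists>P\<in>Bone B. x \<in> P \<and> P \<subseteq> {p..q} \<and> (x < u \<longrightarrow> P \<subseteq> {..<u}) \<and> (u < x \<longrightarrow> P \<subseteq> {u<..})"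
    if x: "x \<in> {p..q}" "x \<noteq> u" for x
  proof -
    obtain r where r: "r \<in> C" "x \<in> {fst r..snd r}" using C(3) x by blast
    have "(fst r, snd r) \<in> B1pairs B" using C(1) r(1) by auto
    then have "saturated (Bone B) {fst r..snd r}" using filled B1pairs_iff[of "fst r" "snd r"] by (simp add: filled_def)
    then obtain P where P: "P \<in> Bone B" "x \<in> P" "P \<subseteq> {fst r..snd r}"
      using r(2) unfolding saturated_def by blast
    have "u < fst r \<or> snd r < u" using C(2) r(1) by fastforce
    moreover have "{fst r..snd r} \<subseteq> {p..q}" using C(3) r(1) by blast
    ultimately show ?thesis using P r(2) by (intro bexI[of _ P]) (auto dest: subsetD)
  qed
  have "saturated (Bone B) {p..u-1}" unfolding saturated_def
  proof
    fix x assume x: "x \<in> {p..u-1}"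
    then have "x < u" "x \<in> {p..q}" using u p by auto
    then obtain P where "P \<in> Bone B" "x \<in> P" "P \<subseteq> {p..q} \<inter> {..<u}" using *[of x] by blast
    moreover have "{p..q} \<inter> {..<u} = {p..u-1}" using u p by auto
    ultimately show "\<exists>P\<in>Bone B. x \<in> P \<and> P \<subseteq> {p..u-1}" by auto
  qed
  moreover have "saturated (Bone B) {u+1..q}" unfolding saturated_def
  proof
    fix x assume x: "x \<in> {u+1..q}"
    then have "u < x" "x \<in> {p..q}" using u p by auto
    then obtain P where "P \<in> Bone B" "x \<in> P" "P \<subseteq> {p..q} \<inter> {u<..}" using *[of x] by blast
    moreover have "{p..q} \<inter> {u<..} = {u+1..q}" using u p by auto
    ultimately show "\<exists>P\<in>Bone B. x \<in> P \<and> P \<subseteq> {u+1..q}" by auto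
  qed
  ultimately show "\<exists>u\<in>{p..q}. saturated (Bone B) {p..u-1} \<and> saturated (Bone B) {u+1..q}" using u by blast
next
  assume "\<exists>u\<in>{p..q}. saturated (Bone B) {p..u-1} \<and> saturated (Bone B) {u+1..q}"
  then obtain u where u: "u \<in> {p..q}" "cov0 B {p..u-1}" "cov0 B {u+1..q}"
    using cov0_iff[OF PN filled] by blast
  from u(2) obtain C where C: "finite C" "C \<subseteq> B1pairs B"
    "\<forall>p\<in>C. \<forall>q\<in>C. p \<noteq> q \<longrightarrow> disjnt {fst p..snd p} {fst q..snd q}"
    "{p..u-1} = (\<Union>p\<in>C. {fst p..snd p})" unfolding cov0_def by blast
  from u(3) obtain D where D: "finite D" "D \<subseteq> B1pairs B"
    "\<forall>p\<in>D. \<forall>q\<in>D. p \<noteq> q \<longrightarrow> disjnt {fst p..snd p} {fst q..snd q}"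
    "{u+1..q} = (\<Union>p\<in>D. {fst p..snd p})" unfolding cov0_def by blast
  have CD: "disjnt {fst r..snd r} {fst t..snd t}" if "r \<in> C" "t \<in> D" for r t
  proof -
    have "{fst r..snd r} \<subseteq> {p..u-1}" "{fst t..snd t} \<subseteq> {u+1..q}" using C(4) D(4) that by blast+
    moreover have "disjnt {p..u-1} {u+1..q}" by (auto simp: disjnt_iff)
    ultimately show ?thesis by (meson disjnt_subset1 disjnt_subset2)
  qed
  have un: "(\<Union>r\<in>C \<union> D. {fst r..snd r}) = {p..u-1} \<union> {u+1..q}" unfolding C(4) D(4) by blast
  show "cov1 B {p..q}" unfolding cov1_def
  proof (intro exI[of _ "C \<union> D"] exI[of _ u] conjI)
    show "\<forall>r\<in>C \<union> D. \<forall>t\<in>C \<union> D. r \<noteq> t \<longrightarrow> disjnt {fst r..snd r} {fst t..snd t}"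
      using C(3) D(3) CD disjnt_sym by blast
    show "u \<notin> (\<Union>r\<in>C \<union> D. {fst r..snd r})" unfolding un using u(1) p by auto
    show "{p..q} = (\<Union>r\<in>C \<union> D. {fst r..snd r}) \<union> {u}" unfolding un using u(1) p by auto
  qed (use C D in auto)
qed

lemma gap_unique:
  assumes PN: "B \<in> PN N" and p: "1 \<le> p" and u: "u \<in> {p..q}" "u' \<in> {p..q}"
    and sat: "saturated (Bone B) {p..u-1}" "saturated (Bone B) {u+1..q}"
      "saturated (Bone B) {p..u'-1}" "saturated (Bone B) {u'+1..q}"
  shows "u = u'"
proof (rule ccontr)
  assume "u \<noteq> u'"
  \<comment> \<open>Both [p, q] without u and [p, q] without u' are unions of blocks; their
    difference would be one with a single point.\<close>
  have "saturated (Bone B) (({p..u-1} \<union> {u+1..q}) - ({p..u'-1} \<union> {u'+1..q}))"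
    using sat by (intro saturated_diff[OF PN Bone_subset] saturated_Un)
  moreover have "({p..u-1} \<union> {u+1..q}) - ({p..u'-1} \<union> {u'+1..q}) = {u'}"
    using \<open>u \<noteq> u'\<close> u p by auto
  ultimately have "even (card {u'})" using even_card_saturated'[OF PN Bone_subset] by metis
  then show False by simp
qed

text \<open>The interval spanned by an odd pair is a union of odd pairs and so misses v. Hence no
  odd pair straddles v, and a union of such pairs may be cut there.\<close>

lemma saturated_split:
  assumes PN: "B \<in> PN N" and filled: "filled B" and v: "v \<notin> \<Union>(Bone B)" and sat: "saturated (Bone B) S"
  shows "saturated (Bone B) (S \<inter> {..<v})" "saturated (Bone B) (S \<inter> {v<..})"
proof -
  have side: "P \<subseteq> {..<v} \<or> P \<subseteq> {v<..}" if P: "P \<in> Bone B" for P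
  proof -
    obtain a b where ab: "(a, b) \<in> arcs B" "a < b" "P = {a, b}" by (rule Bone_pair[OF PN P])
    then have "saturated (Bone B) {a..b}" using filled by (auto simp: filled_def)
    then have "v \<notin> {a..b}" using v unfolding saturated_def by blast
    then show ?thesis using ab by auto
  qed
  have "\<exists>P\<in>Bone B. x \<in> P \<and> P \<subseteq> S \<inter> {..<v}" if "x \<in> S \<inter> {..<v}" for x
  proof -
    obtain P where P: "P \<in> Bone B" "x \<in> P" "P \<subseteq> S" using sat \<open>x \<in> S \<inter> {..<v}\<close> unfolding saturated_def by blast
    have "P \<subseteq> {..<v}" using side[OF P(1)] P(2) \<open>x \<in> S \<inter> {..<v}\<close> by fastforce
    then show ?thesis using P by blast
  qed
  then show "saturated (Bone B) (S \<inter> {..<v})" unfolding saturated_def by blast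
  have "\<exists>P\<in>Bone B. x \<in> P \<and> P \<subseteq> S \<inter> {v<..}" if "x \<in> S \<inter> {v<..}" for x
  proof -
    obtain P where P: "P \<in> Bone B" "x \<in> P" "P \<subseteq> S" using sat \<open>x \<in> S \<inter> {v<..}\<close> unfolding saturated_def by blast
    have "P \<subseteq> {v<..}" using side[OF P(1)] P(2) \<open>x \<in> S \<inter> {v<..}\<close> by fastforce
    then show ?thesis using P by blast
  qed
  then show "saturated (Bone B) (S \<inter> {v<..})" unfolding saturated_def by blast
qed

section \<open>Nested even arcs\<close>

lemma istar_set:
  assumes "istar_seq N B l"
  shows "set l = \<Union>(Bzero B)"
proof -
  define s where "s = card (Bzero B)"
  have l: "length l = 2 * s" "Bzero B = {{l ! (2*s - 1 - k), l ! k} | k. k < s}"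
    using assms by (auto simp: istar_seq_def Let_def s_def)
  have "l ! m \<in> \<Union>(Bzero B)" if m: "m < 2 * s" for m
  proof (cases "m < s")
    case True
    then show ?thesis unfolding l(2) by blast
  next
    case False
    then have k: "2 * s - 1 - (2 * s - 1 - m) = m" "2 * s - 1 - m < s" using m by auto
    have "{l ! (2*s - 1 - (2*s - 1 - m)), l ! (2*s - 1 - m)} \<in> Bzero B"
      unfolding l(2) using k(2) by blast
    then show ?thesis using k(1) by auto
  qed
  moreover have "x \<in> set l" if "x \<in> \<Union>(Bzero B)" for x
    using that l(1) unfolding l(2) by auto
  ultimately show ?thesis using l(1) by (intro equalityI subsetI) (metis in_set_conv_nth, blast)
qed

text \<open>A strictly increasing list is determined by its entries, and by \<open>istar_set\<close>
  these are the points of the even pairs.\<close>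

lemma iseq_eq:
  assumes "istar_seq N B l"
  shows "iseq N B = l"
  unfolding iseq_def
proof (rule the_equality[where P = "istar_seq N B", OF assms])
  fix k assume k: "istar_seq N B k"
  have "sorted_wrt (<) k" "sorted_wrt (<) l" using k assms by (auto simp: istar_seq_def Let_def)
  then show "k = l" using istar_set[OF k] istar_set[OF assms] by (metis strict_sorted_equal)
qed

lemma sorted_locate:
  fixes l :: "nat list"
  assumes "sorted_wrt (<) l" "l \<noteq> []"
  shows "y < hd l \<or> last l < y \<or> y \<in> set l \<or> (\<exists>m. m + 1 < length l \<and> l ! m < y \<and> y < l ! (m + 1))"
  using assms
proof (induction l)
  case (Cons a l)
  show ?case
  proof (cases "l = []")
    case False
    then consider "y < hd l" | "last l < y" | "y \<in> set l" | m where "m + 1 < length l" "l ! m < y" "y < l ! (m + 1)"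
      using Cons by auto
    then show ?thesis
    proof cases
      case 1
      then have "y < a \<or> y = a \<or> (0 + 1 < length (a # l) \<and> (a # l) ! 0 < y \<and> y < (a # l) ! (0 + 1))"
        using False by (auto simp: hd_conv_nth)
      then show ?thesis by (metis hd_conv_nth list.distinct(1) list.sel(1) list.set_intros(1))
    next
      case 4
      then have "Suc m + 1 < length (a # l) \<and> (a # l) ! (Suc m) < y \<and> y < (a # l) ! (Suc m + 1)" by simp
      then show ?thesis by blast
    qed (use False in auto)
  qed auto
qed simp

context
  fixes N B l
  assumes PN: "B \<in> PN N" and istar: "istar_seq N B l"
begin

private abbreviation (input) "s \<equiv> card (Bzero B)"

lemma istar_basic:
  "length l = 2 * s" "sorted_wrt (<) l"
  "k < s \<Longrightarrow> wr (l ! (2*s - 1 - k)) (l ! k)"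
  "k + 1 < 2 * s \<Longrightarrow> k + 1 \<noteq> s \<Longrightarrow> cov0 B {l ! k + 1 .. l ! (k+1) - 1}"
  using istar by (auto simp: istar_seq_def Let_def)

lemma istar_Bzero: "P \<in> Bzero B \<longleftrightarrow> (\<exists>k<s. P = {l ! (2*s - 1 - k), l ! k})"
proof -
  have "Bzero B = {{l ! (2*s - 1 - k), l ! k} | k. k < s}"
    using istar by (simp add: istar_seq_def Let_def)
  from eqset_imp_iff[OF this, of P] show ?thesis by auto
qed

lemma istar_less: "m < n \<Longrightarrow> n < 2 * s \<Longrightarrow> l ! m < l ! n"
  using istar_basic(1,2) by (simp add: sorted_wrt_nth_less)

lemma istar_le_iff: "m < 2 * s \<Longrightarrow> n < 2 * s \<Longrightarrow> l ! m \<le> l ! n \<longleftrightarrow> m \<le> n"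
  using istar_less[of m n] istar_less[of n m] by (cases m n rule: linorder_cases) auto

lemma istar_arc: "k < s \<Longrightarrow> (l ! (2*s - 1 - k), l ! k) \<in> arcs B"
  using istar_basic(3)[of k] istar_Bzero[of "{l ! (2*s - 1 - k), l ! k}"] Bzero_subset[of B]
  unfolding arcs_def by auto

lemma istar_zero_arc:
  assumes "(i, j) \<in> arcs B" "j < i"
  obtains k where "k < s" "i = l ! (2*s - 1 - k)" "j = l ! k"
proof -
  obtain k where k: "k < s" "{i, j} = {l ! (2*s - 1 - k), l ! k}"
    using arc_Bzero[OF assms] istar_Bzero by blast
  then have "i = l ! (2*s - 1 - k) \<and> j = l ! k"
    using arcs_eq[OF PN assms(1) istar_arc[OF k(1)], of i] by auto
  then show thesis using that k by blast
qed

lemma istar_ends: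
  assumes "s > 0"
  shows "l \<noteq> []" "hd l = l ! 0" "last l = l ! (2*s - 1)" "(last l, hd l) \<in> arcs B" "hd l < last l"
proof -
  show ne: "l \<noteq> []" using istar_basic(1) assms by auto
  show h: "hd l = l ! 0" "last l = l ! (2*s - 1)"
    using ne istar_basic(1) by (simp_all add: hd_conv_nth last_conv_nth)
  show "(last l, hd l) \<in> arcs B" using istar_arc[of 0] h assms by simp
  show "hd l < last l" using istar_less[of 0 "2*s - 1"] h assms by simp
qed

lemma istar_bounds:
  assumes "s > 0" "x \<in> \<Union>(Bzero B)"
  shows "hd l \<le> x" "x \<le> last l"
proof -
  obtain m where "m < 2 * s" "x = l ! m"
    using assms(2) istar_set[OF istar] istar_basic(1) by (metis in_set_conv_nth)
  then show "hd l \<le> x" "x \<le> last l" using istar_ends(2,3)[OF assms(1)] istar_le_iff assms(1) by auto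
qed

lemma saturated_outside_Bone:
  assumes "s > 0" "saturated B S" "S \<inter> {hd l..last l} = {}"
  shows "saturated (Bone B) S"
  unfolding saturated_def
proof
  fix x assume x: "x \<in> S"
  then obtain P where P: "P \<in> B" "x \<in> P" "P \<subseteq> S" using assms(2) unfolding saturated_def by blast
  have "P \<notin> Bzero B"
  proof
    assume "P \<in> Bzero B"
    then have "x \<in> {hd l..last l}" using istar_bounds[OF assms(1), of x] P(2) by auto
    then show False using assms(3) x by blast
  qed
  then show "\<exists>P\<in>Bone B. x \<in> P \<and> P \<subseteq> S" using P Bone_or_Bzero[OF PN P(1)] by blast
qed

text \<open>The arc of an even pair consists of the outer stretches before \<open>hd l\<close> and
  after \<open>last l\<close>, the pairs further out, and the covered stretches between consecutive
  entries. \<open>B'\<close> is kept apart from B so that the lemma also serves the extension of B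
  by the pair of N, where only the new pair completes the outer stretches.\<close>

lemma istar_saturated:
  assumes filled: "filled B" and "B \<subseteq> B'" and R: "saturated B' ({1..hd l - 1} \<union> {last l + 1..N})"
    and ij: "(i, j) \<in> arcs B" "j < i"
  shows "saturated B' (brk N i j)"
  unfolding saturated_def
proof
  fix y assume y: "y \<in> brk N i j"
  obtain k where k: "k < s" "i = l ! (2*s - 1 - k)" "j = l ! k" by (rule istar_zero_arc[OF ij])
  then have s: "s > 0" by simp
  note ends = istar_ends[OF s]
  have b: "1 \<le> j" "i \<le> N" using PN_arc[OF PN ij(1)] by auto
  have brk: "z \<in> brk N i j \<longleftrightarrow> (i \<le> z \<and> z \<le> N) \<or> (1 \<le> z \<and> z \<le> j)" for z
    using ij(2) by (auto simp: brk_def)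
  have hdj: "hd l \<le> j" "i \<le> last l"
    using ends istar_le_iff[of 0 k] istar_le_iff[of "2*s-1-k" "2*s-1"] k by auto
  consider "y < hd l" | "last l < y" | "y \<in> set l" | m where "m + 1 < length l" "l ! m < y" "y < l ! (m + 1)"
    using sorted_locate[OF istar_basic(2) ends(1), of y] by blast
  then show "\<exists>P\<in>B'. y \<in> P \<and> P \<subseteq> brk N i j"
  proof cases
    case 3
    then obtain m where m: "m < 2 * s" "y = l ! m" using istar_basic(1) by (metis in_set_conv_nth)
    have cmp: "2*s - 1 - k \<le> m \<or> m \<le> k"
      using y brk istar_le_iff[of "2*s-1-k" m] istar_le_iff[of m k] m k by auto
    \<comment> \<open>Entries m and 2s - 1 - m are partners; n numbers their pair from the
      outside.\<close>
    define n where "n = min m (2*s - 1 - m)"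
    have n: "n \<le> k" "n < s" "y \<in> {l ! (2*s - 1 - n), l ! n}" using cmp m k by (auto simp: n_def min_def)
    have arc: "(l ! (2*s - 1 - n), l ! n) \<in> arcs B" using istar_arc n by blast
    have "l ! n \<le> j" "i \<le> l ! (2*s-1-n)"
      using istar_le_iff[of n k] istar_le_iff[of "2*s-1-k" "2*s-1-n"] n k by auto
    then have "{l ! (2*s - 1 - n), l ! n} \<subseteq> brk N i j" using PN_arc[OF PN arc] brk by auto
    moreover have "{l ! (2*s - 1 - n), l ! n} \<in> B'" using arc assms(2) by (auto simp: arcs_def)
    ultimately show ?thesis using n(3) by (intro bexI[of _ "{l ! (2*s - 1 - n), l ! n}"] conjI)
  next
    case (4 m)
    have m: "m + 1 < 2 * s" using 4(1) istar_basic(1) by simp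
    have cmp: "2*s - 1 - k \<le> m \<or> m + 1 \<le> k"
    proof -
      have "y \<le> j \<or> i \<le> y" using y brk by auto
      then show ?thesis
      proof
        assume "y \<le> j"
        then have "\<not> l ! k \<le> l ! m" using 4 k by linarith
        then show ?thesis using istar_le_iff[of k m] m k by auto
      next
        assume "i \<le> y"
        then have "\<not> l ! (m+1) \<le> l ! (2*s-1-k)" using 4 k by linarith
        then show ?thesis using istar_le_iff[of "m+1" "2*s-1-k"] m k by auto
      qed
    qed
    \<comment> \<open>Only the central stretch, between entries s - 1 and s, need not be covered,
      and it lies outside the arc of every even pair.\<close>
    then have "m + 1 \<noteq> s" using k by auto
    then have "saturated (Bone B) {l ! m + 1 .. l ! (m+1) - 1}"
      using istar_basic(4)[OF m] cov0_iff[OF PN filled] by blast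
    moreover have "y \<in> {l ! m + 1 .. l ! (m+1) - 1}" using 4 by auto
    ultimately obtain P where P: "P \<in> Bone B" "y \<in> P" "P \<subseteq> {l ! m + 1 .. l ! (m+1) - 1}"
      unfolding saturated_def by (auto dest: bspec)
    have "{l ! m + 1 .. l ! (m+1) - 1} \<subseteq> brk N i j"
      using cmp
    proof
      assume "2*s - 1 - k \<le> m"
      then have "i \<le> l ! m" using istar_le_iff[of "2*s-1-k" m] m k by simp
      moreover have "l ! (m+1) \<le> N" 
        using istar m unfolding istar_seq_def Let_def by (metis atLeastAtMost_iff nth_mem subset_code(1))
      ultimately show ?thesis by (intro subsetI) (auto simp: brk)
    next
      assume "m + 1 \<le> k"
      then have "l ! (m+1) \<le> j" using istar_le_iff[of "m+1" k] m k by simp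
      then show ?thesis by (intro subsetI) (auto simp: brk)
    qed
    then have "P \<subseteq> brk N i j" using P(3) by (rule order_trans[rotated])
    moreover have "P \<in> B'" using P(1) Bone_subset assms(2) by blast
    ultimately show ?thesis using P(2) by (intro bexI[of _ P] conjI)
  next
    case 1
    then have "y \<in> {1..hd l - 1} \<union> {last l + 1..N}" using y brk hdj b ij ends(5) by auto
    then obtain P where "P \<in> B'" "y \<in> P" "P \<subseteq> {1..hd l - 1} \<union> {last l + 1..N}"
      using R unfolding saturated_def by blast
    moreover have "{1..hd l - 1} \<union> {last l + 1..N} \<subseteq> brk N i j"
      using hdj by (intro subsetI) (auto simp: brk)
    ultimately show ?thesis by (meson order_trans)
  next
    case 2
    then have "y \<in> {1..hd l - 1} \<union> {last l + 1..N}" using y brk hdj b ij ends(5) by auto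
    then obtain P where "P \<in> B'" "y \<in> P" "P \<subseteq> {1..hd l - 1} \<union> {last l + 1..N}"
      using R unfolding saturated_def by blast
    moreover have "{1..hd l - 1} \<union> {last l + 1..N} \<subseteq> brk N i j"
      using hdj by (intro subsetI) (auto simp: brk)
    ultimately show ?thesis by (meson order_trans)
  qed
qed

end

section \<open>Even pairs layered around an unmatched point\<close>

lemma saturatedE:
  assumes "saturated A S" "x \<in> S"
  obtains P where "P \<in> A" "x \<in> P" "P \<subseteq> S"
  using assms unfolding saturated_def by (auto dest: bspec)

lemma saturated_notin: "saturated A S \<Longrightarrow> v \<notin> \<Union>A \<Longrightarrow> v \<notin> S"
  by (rule notI) (erule (1) saturatedE, blast)

text \<open>The condition on B^0 without the sequence: all even pairs enclose v, and the two
  stretches between any two of them are together a union of blocks. Unlike goodness, this survives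
  the removal of the pair of N, where outer arcs may cease to be unions of blocks.\<close>

definition layered :: "nat \<Rightarrow> nat set set \<Rightarrow> bool" where
  "layered v B \<longleftrightarrow> v \<notin> \<Union>B \<and>
     (\<forall>i j. (i, j) \<in> arcs B \<longrightarrow> j < i \<longrightarrow> j < v \<and> v < i) \<and>
     (\<forall>i j i' j'. (i, j) \<in> arcs B \<longrightarrow> j < i \<longrightarrow> (i', j') \<in> arcs B \<longrightarrow> j' < i' \<longrightarrow> j < j' \<longrightarrow>
        i' < i \<and> saturated B ({j+1..j'-1} \<union> {i'+1..i-1}))"

lemma layered_zero:
  assumes "layered v B" "(i, j) \<in> arcs B" "j < i"
  shows "j < v" "v < i"
  using assms by (auto simp: layered_def)

lemma layered_nested:
  assumes "layered v B" "(i, j) \<in> arcs B" "j < i" "(k, l) \<in> arcs B" "l < k" "j < l"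
  shows "k < i" "saturated B ({j+1..l-1} \<union> {k+1..i-1})"
  using assms unfolding layered_def by metis+

text \<open>Between two consecutive left ends no further even pair fits, so the stretches there
  consist of odd pairs. Cutting at v separates the left stretch from the right one, as the sequence
  condition requires.\<close>

lemma istar_exists:
  assumes PN: "B \<in> PN N" and filled: "filled B" and lay: "layered v B"
  shows "\<exists>l. istar_seq N B l"
proof -
  define J where "J = {j. \<exists>i. (i, j) \<in> arcs B \<and> j < i}"
  define f where "f j = (THE i. (i, j) \<in> arcs B)" for j
  have f: "(f j, j) \<in> arcs B" "j < f j" "f j \<le> N" "1 \<le> j" if "j \<in> J" for j
  proof -
    obtain i where i: "(i, j) \<in> arcs B" "j < i" using \<open>j \<in> J\<close> by (auto simp: J_def)
    have "f j = i" unfolding f_def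
      using i(1) arcs_eq[OF PN _ i(1), of _ j j] by (intro the_equality) blast+
    then show "(f j, j) \<in> arcs B" "j < f j" "f j \<le> N" "1 \<le> j" using i PN_arc[OF PN i(1)] by auto
  qed
  have v: "v \<notin> \<Union>B" using lay by (simp add: layered_def)
  have fv: "j < v" "v < f j" if "j \<in> J" for j
    using layered_zero[OF lay f(1,2)[OF that]] .
  have nest: "f j' < f j" "saturated B ({j+1..j'-1} \<union> {f j'+1..f j-1})"
    if "j \<in> J" "j' \<in> J" "j < j'" for j j'
    using layered_nested[OF lay f(1,2)[OF that(1)] f(1,2)[OF that(2)] that(3)] .
  have gap: "cov0 B {j+1..j'-1}" "cov0 B {f j'+1..f j-1}"
    if j: "j \<in> J" "j' \<in> J" "j < j'" "{j<..<j'} \<inter> J = {}" for j j'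
  proof -
    let ?S = "{j+1..j'-1} \<union> {f j'+1..f j-1}"
    have "saturated (Bone B) ?S" unfolding saturated_def
    proof
      fix x assume "x \<in> ?S"
      then obtain P where P: "P \<in> B" "x \<in> P" "P \<subseteq> ?S" by (rule saturatedE[OF nest(2)[OF j(1-3)]])
      have "P \<notin> Bzero B"
      proof
        assume "P \<in> Bzero B"
        then obtain a b where ab: "(a, b) \<in> arcs B" "b < a" "P = {a, b}" by (rule Bzero_pair[OF PN])
        then have "b \<in> J" by (auto simp: J_def)
        have "b < v" using layered_zero(1)[OF lay ab(1,2)] .
        then have "b \<in> {j+1..j'-1}" using P(3) ab(3) fv(2)[OF j(2)] by auto
        then have "b \<in> {j<..<j'}" by auto
        then show False using \<open>b \<in> J\<close> j(4) by blast
      qed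
      then show "\<exists>P\<in>Bone B. x \<in> P \<and> P \<subseteq> ?S" using P Bone_or_Bzero[OF PN P(1)] by (intro bexI[of _ P]) auto
    qed
    moreover have "v \<notin> \<Union>(Bone B)" using v Bone_subset by blast
    ultimately have "saturated (Bone B) (?S \<inter> {..<v})" "saturated (Bone B) (?S \<inter> {v<..})"
      using saturated_split[OF PN filled] by blast+
    moreover have "?S \<inter> {..<v} = {j+1..j'-1}" "?S \<inter> {v<..} = {f j'+1..f j-1}"
      using fv[OF j(1)] fv[OF j(2)] by auto
    ultimately show "cov0 B {j+1..j'-1}" "cov0 B {f j'+1..f j-1}" by (simp_all add: cov0_iff[OF PN filled])
  qed
  have "J \<subseteq> {1..N}" using f by force
  then have finJ: "finite J" by (rule finite_subset) simp
  define js where "js = sorted_list_of_set J"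
  have js: "sorted_wrt (<) js" "set js = J" "length js = card J"
    using finJ by (simp_all add: js_def)
  have Bz: "Bzero B = (\<lambda>j. {f j, j}) ` J"
  proof (intro equalityI subsetI)
    fix P assume "P \<in> Bzero B"
    then obtain a b where ab: "(a, b) \<in> arcs B" "b < a" "P = {a, b}" by (rule Bzero_pair[OF PN])
    then have "b \<in> J" by (auto simp: J_def)
    moreover have "f b = a" using arcs_eq[OF PN f(1)[OF \<open>b \<in> J\<close>] ab(1), of b] by simp
    ultimately show "P \<in> (\<lambda>j. {f j, j}) ` J" using ab(3) by blast
  next
    fix P assume "P \<in> (\<lambda>j. {f j, j}) ` J"
    then show "P \<in> Bzero B" using f arc_Bzero by blast
  qed
  have "inj_on (\<lambda>j. {f j, j}) J"
    using f arcs_eq[OF PN] by (intro inj_onI) (metis insertCI)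
  then have cardJ: "card (Bzero B) = card J" unfolding Bz by (rule card_image)
  \<comment> \<open>Nesting makes the partners decrease along the left ends, so reversing them
    yields an increasing list in which entry 2s - 1 - k is the partner of entry k.\<close>
  define l where "l = js @ rev (map f js)"
  let ?s = "card J"
  have l1: "l ! k = js ! k" if "k < ?s" for k using that js by (simp add: l_def nth_append)
  have l2: "l ! (2 * ?s - 1 - k) = f (js ! k)" if "k < ?s" for k
  proof -
    have "\<not> 2 * ?s - 1 - k < length js" "2 * ?s - 1 - k - length js = ?s - Suc k" using that js(3) by auto
    then have "l ! (2 * ?s - 1 - k) = rev (map f js) ! (?s - Suc k)" by (simp add: l_def nth_append)
    also have "\<dots> = map f js ! k" using that js(3) by (subst rev_nth) (auto simp: Suc_diff_Suc)
    finally show ?thesis using that js(3) by simp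
  qed
  have jJ: "js ! k \<in> J" if "k < ?s" for k using that js by (metis nth_mem)
  have consec: "{js ! k<..<js ! Suc k} \<inter> J = {}" "js ! k < js ! Suc k" if k: "Suc k < ?s" for k
  proof -
    have mono: "js ! m < js ! n" if "m < n" "n < ?s" for m n
      using js that by (simp add: sorted_wrt_nth_less)
    show "js ! k < js ! Suc k" using mono k by simp
    have False if "x \<in> J" "js ! k < x" "x < js ! Suc k" for x
    proof -
      obtain m where m: "m < ?s" "x = js ! m" using \<open>x \<in> J\<close> js by (metis in_set_conv_nth)
      then have "\<not> m \<le> k" "\<not> Suc k \<le> m"
        using that(2,3) mono[of m k] mono[of "Suc k" m] k by (auto simp: le_less)
      then show False by simp
    qed
    then show "{js ! k<..<js ! Suc k} \<inter> J = {}" by auto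
  qed
  have "istar_seq N B l"
    unfolding istar_seq_def Let_def cardJ
  proof (intro conjI allI impI)
    show "length l = 2 * ?s" using js by (simp add: l_def)
    have "sorted_wrt (\<lambda>x y. f y < f x) js"
      by (rule sorted_wrt_mono_rel[OF _ js(1)]) (use nest(1) js(2) in blast)
    then show "sorted_wrt (<) l"
      using js fv by (fastforce simp: l_def sorted_wrt_append sorted_wrt_rev sorted_wrt_map)
    show "set l \<subseteq> {1..N}" using f js(2) by (force simp: l_def)
    show "Bzero B = {{l ! (2 * ?s - 1 - k), l ! k} | k. k < ?s}"
    proof -
      have "(\<lambda>k. js ! k) ` {..<?s} = J" using js(2,3) by (auto simp: set_conv_nth)
      then have "Bzero B = (\<lambda>j. {f j, j}) ` (\<lambda>k. js ! k) ` {..<?s}" unfolding Bz by simp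
      also have "\<dots> = (\<lambda>k. {l ! (2 * ?s - 1 - k), l ! k}) ` {..<?s}"
        unfolding image_image by (rule image_cong) (simp_all add: l1 l2[simplified])
      also have "\<dots> = {{l ! (2 * ?s - 1 - k), l ! k} | k. k < ?s}" by (simp add: setcompr_eq_image lessThan_def)
      finally show ?thesis .
    qed
    show "wr (l ! (2 * ?s - 1 - k)) (l ! k)" if "k < ?s" for k
      using l1 l2 jJ f(1) that by (simp add: arcs_def)
    fix k assume k: "k + 1 < 2 * ?s \<and> k + 1 \<noteq> ?s"
    show "cov0 B {l ! k + 1 .. l ! (k + 1) - 1}"
    proof (cases "k + 1 < ?s")
      case True
      then show ?thesis using gap(1)[OF jJ jJ consec(2,1), of k] l1 by simp
    next
      case False
      \<comment> \<open>In the right half the stretch after position k mirrors the stretch between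
        the left ends n and n + 1.\<close>
      define n where "n = 2 * ?s - 2 - k"
      have n: "Suc n < ?s" "k = 2 * ?s - 1 - Suc n" "k + 1 = 2 * ?s - 1 - n" using k False by (auto simp: n_def)
      then have "l ! k = f (js ! Suc n)" "l ! (k + 1) = f (js ! n)" using l2 by (metis, metis Suc_lessD)
      then show ?thesis using gap(2)[OF jJ jJ consec(2,1), of n] n(1) by simp
    qed
  qed
  then show ?thesis ..
qed

section \<open>Good matchings and condition (I)\<close>

lemma StarP_I: "B \<in> PN N \<Longrightarrow> filled B \<Longrightarrow> layered v B \<Longrightarrow> B \<in> StarP N"
  using istar_exists filled_iff by (auto simp: StarP_def)

lemma StarP_D:
  assumes "B \<in> StarP N"
  shows "B \<in> PN N" "filled B" "istar_seq N B (iseq N B)"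
proof -
  show PN: "B \<in> PN N" using assms by (simp add: StarP_def)
  show "filled B" using assms by (simp add: StarP_def filled_iff[OF PN])
  obtain l where "istar_seq N B l" using assms by (auto simp: StarP_def)
  then show "istar_seq N B (iseq N B)" using iseq_eq by metis
qed

lemma Good_zero_arc:
  assumes "B \<in> Good N" "v \<notin> \<Union>B" "1 \<le> v" "v \<le> N" "(i, j) \<in> arcs B" "j < i"
  shows "j < v" "v < i"
  using Good_free[OF assms(1,5,2)] assms(3,4,6) by (auto simp: brk_def split: if_splits)

text \<open>An even pair with both ends in [a, b] would enclose v, which would then lie in a union
  of blocks.\<close>

lemma Good_filled:
  assumes odd: "odd N" and B: "B \<in> Good N"
  shows "filled B"
  unfolding filled_def
proof (intro allI impI)
  note PN = Good_PN[OF B]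
  obtain v where v: "1 \<le> v" "v \<le> N" "v \<notin> \<Union>B" using free_point[OF odd PN] by blast
  fix a b assume ab: "(a, b) \<in> arcs B" "a < b"
  then have sat: "saturated B {a..b}" using Good_saturated[OF B ab(1)] by (simp add: brk_def)
  show "saturated (Bone B) {a..b}" unfolding saturated_def
  proof
    fix x assume "x \<in> {a..b}"
    then obtain P where P: "P \<in> B" "x \<in> P" "P \<subseteq> {a..b}" by (rule saturatedE[OF sat])
    have "P \<notin> Bzero B"
    proof
      assume "P \<in> Bzero B"
      then obtain i j where ij: "(i, j) \<in> arcs B" "j < i" "P = {i, j}" by (rule Bzero_pair[OF PN])
      then have "j < v" "v < i" using Good_zero_arc[OF B v(3,1,2)] by auto
      then have "v \<in> {a..b}" using P(3) ij(3) by auto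
      then show False using saturated_notin[OF sat v(3)] by simp
    qed
    then show "\<exists>P\<in>Bone B. x \<in> P \<and> P \<subseteq> {a..b}" using P Bone_or_Bzero[OF PN P(1)] by (intro bexI[of _ P]) auto
  qed
qed

text \<open>Arcs of even pairs run through N, so the pair nearer to v has the larger arc. Removing
  from it the arc of the outer pair and the points k and l leaves just the two stretches.\<close>

lemma Good_nested:
  assumes B: "B \<in> Good N" and v: "v \<notin> \<Union>B" "1 \<le> v" "v \<le> N"
    and ij: "(i, j) \<in> arcs B" "j < i" and kl: "(k, l) \<in> arcs B" "l < k" and jl: "j < l"
  shows "k < i" "saturated B ({j+1..l-1} \<union> {k+1..i-1})"
proof -
  note PN = Good_PN[OF B]
  note b = PN_arc[OF PN ij(1)] PN_arc[OF PN kl(1)]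
  have ne: "i \<noteq> k" using arcs_eq[OF PN ij(1) kl(1), of i] jl by auto
  have "l < v" "v < i" using Good_zero_arc[OF B v kl] Good_zero_arc[OF B v ij] by auto
  then have "l \<notin> brk N i j" using ij jl by (auto simp: brk_def)
  then have "k \<notin> brk N i j" using Good_brk_iff[OF B ij(1) kl(1)] by simp
  then show "k < i" using ij b ne by (auto simp: brk_def)
  have "saturated B (brk N k l - brk N i j - {k, l})"
    by (rule saturated_diff[OF PN subset_refl saturated_diff[OF PN subset_refl Good_saturated[OF B kl(1)]
          Good_saturated[OF B ij(1)]] saturated_block]) (rule PN_arc(6)[OF PN kl(1)])
  moreover have "brk N k l - brk N i j - {k, l} = {j+1..l-1} \<union> {k+1..i-1}"
    using ij kl b \<open>k < i\<close> jl \<open>l < v\<close> \<open>v < i\<close> by (auto simp: brk_def)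
  ultimately show "saturated B ({j+1..l-1} \<union> {k+1..i-1})" by simp
qed

lemma Good_layered:
  assumes "B \<in> Good N" "v \<notin> \<Union>B" "1 \<le> v" "v \<le> N"
  shows "layered v B"
  unfolding layered_def using assms(2) Good_zero_arc[OF assms] Good_nested[OF assms] by blast

lemma Good_StarP:
  assumes "odd N" "B \<in> Good N"
  shows "B \<in> StarP N"
proof -
  obtain v where "1 \<le> v" "v \<le> N" "v \<notin> \<Union>B" using free_point[OF assms(1) Good_PN[OF assms(2)]] by blast
  then show ?thesis using StarP_I Good_PN Good_filled Good_layered assms by metis
qed

text \<open>The arc of the outermost even pair without its ends is the union of the two outer
  stretches; cutting at v separates them.\<close>

lemma Good_condI:
  assumes odd: "odd N" and B: "B \<in> Good N"
  shows "condI N B"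
proof (cases "card (Bzero B) = 0")
  case False
  note PN = Good_PN[OF B] and filled = Good_filled[OF odd B]
  obtain v where v: "1 \<le> v" "v \<le> N" "v \<notin> \<Union>B" using free_point[OF odd PN] by blast
  define l where "l = iseq N B"
  have istar: "istar_seq N B l" using StarP_D(3)[OF Good_StarP[OF odd B]] by (simp add: l_def)
  have s: "card (Bzero B) > 0" using False by simp
  note ends = istar_ends[OF PN istar s]
  let ?R = "{1..hd l - 1} \<union> {last l + 1..N}"
  have b: "1 \<le> hd l" "last l \<le> N" using PN_arc[OF PN ends(4)] by auto
  have "saturated B (brk N (last l) (hd l) - {last l, hd l})"
    by (rule saturated_diff[OF PN subset_refl Good_saturated[OF B ends(4)] saturated_block])
      (rule PN_arc(6)[OF PN ends(4)])
  moreover have "brk N (last l) (hd l) - {last l, hd l} = ?R"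
    using ends(5) b by (auto simp: brk_def)
  ultimately have "saturated B ?R" by simp
  then have "saturated (Bone B) ?R"
    using ends(5) by (intro saturated_outside_Bone[OF PN istar s]) auto
  moreover have "v \<notin> \<Union>(Bone B)" using v Bone_subset by blast
  ultimately have "saturated (Bone B) (?R \<inter> {..<v})" "saturated (Bone B) (?R \<inter> {v<..})"
    using saturated_split[OF PN filled] by blast+
  moreover have "?R \<inter> {..<v} = {1..hd l - 1}" "?R \<inter> {v<..} = {last l + 1..N}"
    using Good_zero_arc[OF B v(3,1,2) ends(4,5)] by auto
  ultimately show ?thesis
    by (simp add: condI_def Let_def cov0_iff[OF PN filled] flip: l_def)
qed (simp add: condI_def)

text \<open>With \<open>Good_StarP\<close> and \<open>Good_condI\<close>, for odd N, this identifies
  the good matchings with the members of \<open>StarP N\<close> satisfying (I).\<close>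

lemma StarP_condI_Good:
  assumes B: "B \<in> StarP N" and I: "condI N B"
  shows "B \<in> Good N"
proof -
  note PN = StarP_D(1)[OF B] and filled = StarP_D(2)[OF B]
  define l where "l = iseq N B"
  have istar: "istar_seq N B l" using StarP_D(3)[OF B] by (simp add: l_def)
  have "saturated B (brk N i j)" if ij: "(i, j) \<in> arcs B" for i j
  proof (cases "i < j")
    case True
    then have "saturated (Bone B) {i..j}" using filled ij by (simp add: filled_def)
    then show ?thesis using True saturated_mono[OF _ Bone_subset] by (simp add: brk_def)
  next
    case False
    then have ji: "j < i" using PN_arc(5)[OF PN ij] by simp
    obtain k where "k < card (Bzero B)" by (rule istar_zero_arc[OF PN istar ij ji])
    then have "saturated (Bone B) {1..hd l - 1}" "saturated (Bone B) {last l + 1..N}"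
      using I by (auto simp: condI_def Let_def cov0_iff[OF PN filled] l_def)
    then have "saturated B ({1..hd l - 1} \<union> {last l + 1..N})"
      using saturated_Un saturated_mono[OF _ Bone_subset] by blast
    then show ?thesis by (rule istar_saturated[OF PN istar filled subset_refl _ ij ji])
  qed
  then show ?thesis using PN by (simp add: Good_def)
qed

lemma depth_N: "B \<in> PN N \<Longrightarrow> depth N B N = card (Bzero B)"
  using depth_0 depth_eq_0 by simp

text \<open>The gap after N has depth |B^0|. It is the higher gap at N if N is written first in its
  pair; if N is written last, the gap before it has depth |B^0| + 1.\<close>

lemma N_in_wsum:
  assumes odd: "odd N" and B: "B \<in> Good N"
  shows "(N, u) \<in> arcs B \<Longrightarrow> N \<in> wsum N B \<longleftrightarrow> odd (card (Bzero B))"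
    and "(u, N) \<in> arcs B \<Longrightarrow> N \<in> wsum N B \<longleftrightarrow> even (card (Bzero B))"
    and "N \<notin> \<Union>B \<Longrightarrow> N \<notin> wsum N B \<and> card (Bzero B) = 0"
proof -
  note PN = Good_PN[OF B]
  have N: "1 \<le> N" "N \<le> N" using odd by (auto simp: Suc_le_eq odd_pos)
  note d = depth_N[OF PN]
  show "N \<in> wsum N B \<longleftrightarrow> odd (card (Bzero B))" if arc: "(N, u) \<in> arcs B"
  proof -
    obtain a where "depth N B N = Suc a" "N \<in> wsum N B \<longleftrightarrow> even a"
      using depth_cases(1)[OF PN N arc] by (elim conjE) (rule that; assumption)
    then show ?thesis using d by simp
  qed
  show "N \<in> wsum N B \<longleftrightarrow> even (card (Bzero B))" if arc: "(u, N) \<in> arcs B"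
  proof -
    obtain a where "depth N B N = a" "N \<in> wsum N B \<longleftrightarrow> even a"
      using depth_cases(2)[OF PN N arc] by (elim conjE) (rule that; assumption)
    then show ?thesis using d by simp
  qed
  show "N \<notin> wsum N B \<and> card (Bzero B) = 0" if "N \<notin> \<Union>B"
    using Good_depth_free[OF B N that] d by simp
qed

lemma arc_N_parity:
  assumes "odd N" "B \<in> PN N"
  shows "(N, u) \<in> arcs B \<Longrightarrow> odd u \<and> u < N" and "(u, N) \<in> arcs B \<Longrightarrow> even u \<and> u < N"
proof -
  show "odd u \<and> u < N" if "(N, u) \<in> arcs B"
  proof -
    have "u < N" "even (N - u)" using PN_arc[OF assms(2) that] by (auto simp: wr_def)
    then show ?thesis using assms(1) by auto
  qed
  show "even u \<and> u < N" if "(u, N) \<in> arcs B"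
  proof -
    have "u < N" "odd (N - u)" using PN_arc[OF assms(2) that] by (auto simp: wr_def)
    then show ?thesis using assms(1) by auto
  qed
qed

lemma pair_N_iff:
  assumes PN: "B \<in> PN N" and "{u, N} \<in> B"
  shows "{i, N} \<in> B \<longleftrightarrow> i = u"
proof
  assume "{i, N} \<in> B"
  then have "{i, N} = {u, N}" using PN_disjoint[OF PN _ assms(2), of "{i, N}" N] by simp
  moreover have "card {u, N} = 2" "card {i, N} = 2" using PN \<open>{i, N} \<in> B\<close> assms(2) by (auto simp: PN_def)
  ultimately show "i = u" by (auto simp: doubleton_eq_iff)
qed (use assms in simp)

text \<open>An odd partner of N means that N is written first, an even one that it is written last.
  Comparison with \<open>N_in_wsum\<close> shows that the parity clauses of (III) say precisely that
  N lies in the sum.\<close>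

lemma Xm_eq:
  assumes odd: "odd N"
  shows "Xm N = {B \<in> Good N. N \<in> wsum N B}"
proof -
  have "condIII N B \<longleftrightarrow> N \<in> wsum N B" if B: "B \<in> Good N" for B
  proof -
    note PN = Good_PN[OF B]
    have I: "condI N B" using Good_condI[OF odd B] .
    consider u where "(N, u) \<in> arcs B" | u where "(u, N) \<in> arcs B" | "N \<notin> \<Union>B"
      using in_Union_arcs[OF PN] by blast
    then show ?thesis
    proof cases
      case (1 u)
      then have "{u, N} \<in> B" by (auto simp: arcs_def insert_commute)
      then show ?thesis using I N_in_wsum(1)[OF odd B 1] arc_N_parity(1)[OF odd PN 1]
        by (auto simp: condIII_def pair_N_iff[OF PN])
    next
      case (2 u)
      then have "{u, N} \<in> B" by (auto simp: arcs_def)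
      then show ?thesis using I N_in_wsum(2)[OF odd B 2] arc_N_parity(2)[OF odd PN 2]
        by (auto simp: condIII_def pair_N_iff[OF PN])
    next
      case 3
      then have "{i, N} \<notin> B" for i by auto
      then show ?thesis using N_in_wsum(3)[OF odd B 3] by (auto simp: condIII_def)
    qed
  qed
  moreover have "B \<in> StarP N \<and> condIII N B \<longrightarrow> B \<in> Good N" for B
    using StarP_condI_Good by (auto simp: condIII_def)
  ultimately show ?thesis
    using Good_StarP[OF odd] unfolding Xm_def by (intro Collect_cong) blast
qed

section \<open>Removing and adding the pair of the last point\<close>

lemma PN_subset: "B' \<in> PN N \<Longrightarrow> B \<subseteq> B' \<Longrightarrow> B \<in> PN N"
  unfolding PN_def using pairwise_subset finite_subset by (auto; blast)

definition drop_point :: "nat \<Rightarrow> nat set set \<Rightarrow> nat set set" where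
  "drop_point N B = {P \<in> B. N \<notin> P}"

lemma arcs_drop: "(i, j) \<in> arcs (drop_point N B) \<longleftrightarrow> (i, j) \<in> arcs B \<and> i \<noteq> N \<and> j \<noteq> N"
  by (auto simp: arcs_def drop_point_def)

lemma Bone_drop: "Bone (drop_point N B) = drop_point N (Bone B)"
  and Bzero_drop: "Bzero (drop_point N B) = drop_point N (Bzero B)"
  by (auto simp: Bone_def Bzero_def drop_point_def)

lemma drop_subset: "drop_point N B \<subseteq> B"
  by (auto simp: drop_point_def)

lemma saturated_drop: "saturated B S \<Longrightarrow> N \<notin> S \<Longrightarrow> saturated (drop_point N B) S"
  unfolding saturated_def drop_point_def by (metis (mono_tags, lifting) mem_Collect_eq subsetD)

lemma drop_filled:
  assumes "B \<in> PN N" "filled B"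
  shows "filled (drop_point N B)"
  unfolding filled_def
proof (intro allI impI)
  fix a b assume "(a, b) \<in> arcs (drop_point N B)" "a < b"
  then have ab: "(a, b) \<in> arcs B" "a < b" "b \<noteq> N" by (auto simp: arcs_drop)
  then have "b < N" using PN_arc[OF assms(1) ab(1)] by simp
  then show "saturated (Bone (drop_point N B)) {a..b}"
    using assms(2) ab unfolding Bone_drop by (intro saturated_drop) (auto simp: filled_def)
qed

text \<open>The stretches between two even pairs stay strictly below the larger end i of the outer
  pair, so they never contain N and lose no block.\<close>

lemma drop_layered:
  assumes PN: "B \<in> PN N" and lay: "layered v B" and v: "v \<le> N"
  shows "layered v (drop_point N B)"
  unfolding layered_def
proof (intro conjI allI impI)
  show "v \<notin> \<Union>(drop_point N B)" using lay drop_subset[of N B] by (auto simp: layered_def)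
  fix i j assume ij: "(i, j) \<in> arcs (drop_point N B)" "j < i"
  then have ij': "(i, j) \<in> arcs B" by (simp add: arcs_drop)
  show "j < v" "v < i" using layered_zero[OF lay ij' ij(2)] .
  fix k l assume kl: "(k, l) \<in> arcs (drop_point N B)" "l < k" "j < l"
  then have kl': "(k, l) \<in> arcs B" by (simp add: arcs_drop)
  note nest = layered_nested[OF lay ij' ij(2) kl' kl(2,3)]
  show "k < i" by (fact nest(1))
  have "l < v" using layered_zero[OF lay kl' kl(2)] by simp
  then have "N \<notin> {j+1..l-1} \<union> {k+1..i-1}"
    using PN_arc(2)[OF PN ij'] v nest(1) by auto
  then show "saturated (drop_point N B) ({j+1..l-1} \<union> {k+1..i-1})"
    by (rule saturated_drop[OF nest(2)])
qed

lemma arcs_insert: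
  assumes "wr p q"
  shows "arcs (insert {p, q} B) = insert (p, q) (arcs B)"
  using assms wr_antisym[OF assms] by (auto simp: arcs_def doubleton_eq_iff)

lemma wsum_insert:
  assumes "finite (arcs B)" "(p, q) \<notin> arcs B" "arcs B' = insert (p, q) (arcs B)"
  shows "wsum N B' = sdiff (wsum N B) (brk N p q)"
proof -
  have "card {r \<in> arcs B'. x \<in> brk N (fst r) (snd r)}
      = card {r \<in> arcs B. x \<in> brk N (fst r) (snd r)} + of_bool (x \<in> brk N p q)" for x
  proof -
    have "{r \<in> arcs B'. x \<in> brk N (fst r) (snd r)} =
      (if x \<in> brk N p q then insert (p, q) {r \<in> arcs B. x \<in> brk N (fst r) (snd r)}
       else {r \<in> arcs B. x \<in> brk N (fst r) (snd r)})"
      using assms(3) by auto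
    then show ?thesis using assms(1,2) by simp
  qed
  then show ?thesis by (auto simp: wsum_eq sdiff_def)
qed

lemma uB_case_i:
  assumes PN: "B \<in> PN N" and filled: "filled B" and istar: "istar_seq N B l"
    and u: "u \<in> {1..hd l - 1}" "saturated (Bone B) {1..u-1}" "saturated (Bone B) {u+1..hd l - 1}"
    and R: "saturated (Bone B) {last l + 1..N - 1}"
  shows "case_i N B" "uB N B = u"
proof -
  have "cov1 B {1..hd l - 1}" using cov1_iff[OF PN filled, of 1] u by auto
  then show c: "case_i N B"
    using R cov0_iff[OF PN filled] by (simp add: case_i_def Let_def iseq_eq[OF istar])
  have "(THE u. u \<in> {1..hd l - 1} \<and> cov0 B {1..u - 1} \<and> cov0 B {u + 1..hd l - 1}) = u"
  proof (rule the_equality)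
    show "u \<in> {1..hd l - 1} \<and> cov0 B {1..u - 1} \<and> cov0 B {u + 1..hd l - 1}"
      using u by (simp add: cov0_iff[OF PN filled])
    show "u' = u" if "u' \<in> {1..hd l - 1} \<and> cov0 B {1..u' - 1} \<and> cov0 B {u' + 1..hd l - 1}" for u'
      using that u by (intro gap_unique[OF PN order_refl, of u' "hd l - 1" u]) (auto simp: cov0_iff[OF PN filled])
  qed
  then show "uB N B = u" using c by (simp add: uB_def Let_def iseq_eq[OF istar])
qed

lemma uB_case_ii:
  assumes PN: "B \<in> PN N" and filled: "filled B" and istar: "istar_seq N B l"
    and u: "u \<in> {last l + 1..N - 1}" "saturated (Bone B) {last l + 1..u-1}" "saturated (Bone B) {u+1..N - 1}"
    and L: "saturated (Bone B) {1..hd l - 1}"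
  shows "case_ii N B" "uB N B = u"
proof -
  have "cov1 B {last l + 1..N - 1}" using cov1_iff[OF PN filled, of "last l + 1"] u by auto
  then show "case_ii N B"
    using L cov0_iff[OF PN filled] by (simp add: case_ii_def Let_def iseq_eq[OF istar])
  \<comment> \<open>\<open>uB\<close> tests \<open>case_i\<close> first, so that case has to be
    excluded: it would give the stretch before \<open>hd l\<close> an odd number of points, while
    here it is a union of pairs.\<close>
  have c: "\<not> case_i N B"
  proof
    assume "case_i N B"
    then have "cov1 B {1..hd l - 1}" by (simp add: case_i_def Let_def iseq_eq[OF istar])
    then obtain w where w: "w \<in> {1..hd l - 1}" "saturated (Bone B) {1..w-1}" "saturated (Bone B) {w+1..hd l - 1}"
      using cov1_iff[OF PN filled, of 1] by auto
    have "even (card {1..w-1})" "even (card {w+1..hd l - 1})" "even (card {1..hd l - 1})"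
      using w L even_card_saturated'[OF PN Bone_subset] by blast+
    then have "even (w - 1)" "even (hd l - 1 - w)" "even (hd l - 1)" by simp_all
    moreover have "hd l - 1 = (w - 1) + (hd l - 1 - w) + 1" using w(1) by auto
    ultimately show False by (metis even_add odd_one)
  qed
  have "(THE u. u \<in> {last l + 1..N - 1} \<and> cov0 B {last l + 1..u - 1} \<and> cov0 B {u + 1..N - 1}) = u"
  proof (rule the_equality)
    show "u \<in> {last l + 1..N - 1} \<and> cov0 B {last l + 1..u - 1} \<and> cov0 B {u + 1..N - 1}"
      using u by (simp add: cov0_iff[OF PN filled])
    show "u' = u" if "u' \<in> {last l + 1..N - 1} \<and> cov0 B {last l + 1..u' - 1} \<and> cov0 B {u' + 1..N - 1}" for u'
      using that u
      by (intro gap_unique[OF PN, of "last l + 1" u' "N - 1" u]) (auto simp: cov0_iff[OF PN filled])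
  qed
  then show "uB N B = u" using c by (simp add: uB_def Let_def iseq_eq[OF istar])
qed

lemma Xm_N: "B \<in> Xm N \<Longrightarrow> N \<in> \<Union>B"
  by (cases "even (card (Bzero B))") (auto simp: Xm_def condIII_def)

lemma sdiff_disjoint_union: "S \<inter> T = {} \<Longrightarrow> sdiff (sdiff X S) T = sdiff X (S \<union> T)"
  by (auto simp: sdiff_def)

text \<open>Relates B to its completion \<open>B'\<close>. The last clause prepares the grading: for
  odd u_B the added pair of N is even and raises |B^0| by one, for even u_B it is odd and leaves
  |B^0| unchanged.\<close>

definition Xp_lift :: "nat \<Rightarrow> nat set set \<Rightarrow> nat set set \<Rightarrow> bool" where
  "Xp_lift N B B' \<longleftrightarrow> B \<in> Xp N \<and> eps N B = wsum N B' \<and>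
     (card (Bzero B) = 0 \<and> card (Bzero B') = 0 \<or>
      odd (card (Bzero B)) \<and> odd (uB N B) \<and> card (Bzero B') = Suc (card (Bzero B)) \<or>
      odd (card (Bzero B)) \<and> even (uB N B) \<and> card (Bzero B') = card (Bzero B))"

context
  fixes N B' B v
  assumes odd: "odd N" and B': "B' \<in> Good N" and Nw: "N \<notin> wsum N B'"
    and v: "1 \<le> v" "v \<le> N" "v \<notin> \<Union>B'"
    and B_eq: "B = drop_point N B'"
begin

lemma drop_basics:
  shows "B \<in> PN N" "B' \<in> PN N" "filled B" "filled B'" "B \<in> StarP N" "N \<notin> \<Union>B" "istar_seq N B (iseq N B)"
    "v \<notin> \<Union>(Bone B)" "layered v B'"
proof -
  show PN': "B' \<in> PN N" using Good_PN[OF B'] .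
  show PN: "B \<in> PN N" using PN_subset[OF PN' drop_subset] B_eq by simp
  show f': "filled B'" using Good_filled[OF odd B'] .
  show f: "filled B" using drop_filled[OF PN' f'] B_eq by simp
  show l': "layered v B'" using Good_layered[OF B' v(3,1,2)] .
  have "layered v B" using drop_layered[OF PN' l' v(2)] B_eq by simp
  then show "B \<in> StarP N" using StarP_I[OF PN f] by simp
  then show "istar_seq N B (iseq N B)" by (rule StarP_D(3))
  show "N \<notin> \<Union>B" using B_eq by (auto simp: drop_point_def)
  show "v \<notin> \<Union>(Bone B)" using v(3) Bone_subset[of B] B_eq drop_subset[of N B'] by blast
qed

lemma drop_unmatched:
  assumes "N \<notin> \<Union>B'"
  shows "Xp_lift N B B'"
proof -
  have "B = B'" using assms B_eq by (auto simp: drop_point_def)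
  moreover have "card (Bzero B') = 0" using N_in_wsum(3)[OF odd B' assms] by simp
  ultimately show ?thesis using drop_basics(5) assms
    by (simp add: Xp_lift_def Xp_def condII_def suppB_def eps_def)
qed

text \<open>The pair of N is the outermost even pair. The space between it and the next one, cut at
  v, gives the stretches from u to \<open>hd l\<close> and from \<open>last l\<close> to N, and its
  own arc gives [1, u - 1]; this is case (i) with u_B = u.\<close>

lemma drop_zero_arc:
  assumes arc: "(N, u) \<in> arcs B'"
  shows "Xp_lift N B B'"
proof -
  note PN = drop_basics(1) and PN' = drop_basics(2) and filled = drop_basics(3)
  define l where "l = iseq N B"
  have istar: "istar_seq N B l" using drop_basics(7) by (simp add: l_def)
  have u: "1 \<le> u" "u < N" "odd u" using arc_N_parity(1)[OF odd PN' arc] PN_arc[OF PN' arc] by auto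
  have only: "P = {N, u}" if "P \<in> B'" "N \<in> P" for P
    using PN_disjoint[OF PN' \<open>P \<in> B'\<close> PN_arc(6)[OF PN' arc], of N] that by simp
  have "{N, u} \<in> Bzero B'" using arc_Bzero[OF arc u(2)] .
  moreover have BzB: "P \<in> Bzero B \<longleftrightarrow> P \<in> Bzero B' \<and> N \<notin> P" for P
    unfolding B_eq Bzero_drop by (simp add: drop_point_def)
  ultimately have "P \<in> Bzero B' \<longleftrightarrow> P = {N, u} \<or> P \<in> Bzero B" for P
    using only[of P] subsetD[OF Bzero_subset, of P B'] by blast
  then have Bz: "Bzero B' = insert {N, u} (Bzero B)" "{N, u} \<notin> Bzero B"
    using BzB[of "{N, u}"] by auto
  have "finite (Bzero B)" using PN Bzero_subset[of B] by (auto simp: PN_def intro: finite_subset)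
  then have card: "card (Bzero B') = Suc (card (Bzero B))" using Bz by simp
  have ev: "even (card (Bzero B'))" using N_in_wsum(1)[OF odd B' arc] Nw by simp
  then have s: "card (Bzero B) > 0" "odd (card (Bzero B))" using card by (auto intro: Nat.gr0I)
  note ends = istar_ends[OF PN istar s(1)]
  have ends': "(last l, hd l) \<in> arcs B'" "last l \<noteq> N" using ends(4) by (auto simp: B_eq arcs_drop)
  have lN: "last l < N" using PN_arc[OF PN ends(4)] ends'(2) by simp
  have "u \<noteq> hd l" using arcs_eq[OF PN' arc ends'(1), of u] ends'(2) by auto
  \<comment> \<open>Otherwise the pair of N would be nested inside the pair of \<open>last l\<close>
    and \<open>hd l\<close>, forcing N < last l.\<close>
  moreover have "\<not> hd l < u"
    using Good_nested(1)[OF B' v(3,1,2) ends'(1) ends(5) arc u(2)] lN by auto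
  ultimately have uh: "u < hd l" by simp
  have hv: "hd l < v" "v < last l" using Good_zero_arc[OF B' v(3,1,2) ends'(1) ends(5)] by auto
  have "saturated B' ({u+1..hd l - 1} \<union> {last l + 1..N - 1})"
    using Good_nested(2)[OF B' v(3,1,2) arc u(2) ends'(1) ends(5) uh] .
  then have "saturated B ({u+1..hd l - 1} \<union> {last l + 1..N - 1})"
    unfolding B_eq by (rule saturated_drop) (use lN ends(5) in auto)
  then have "saturated (Bone B) ({u+1..hd l - 1} \<union> {last l + 1..N - 1})"
    using ends(5) by (intro saturated_outside_Bone[OF PN istar s(1)]) auto
  note split = saturated_split[OF PN filled drop_basics(8) this]
  have "({u+1..hd l - 1} \<union> {last l + 1..N - 1}) \<inter> {..<v} = {u+1..hd l - 1}"
    "({u+1..hd l - 1} \<union> {last l + 1..N - 1}) \<inter> {v<..} = {last l + 1..N - 1}"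
    using hv by auto
  then have sat: "saturated (Bone B) {u+1..hd l - 1}" "saturated (Bone B) {last l + 1..N - 1}"
    using split by simp_all
  have "saturated B' (brk N N u - {N, u})"
    by (rule saturated_diff[OF PN' subset_refl Good_saturated[OF B' arc] saturated_block])
      (rule PN_arc(6)[OF PN' arc])
  moreover have "brk N N u - {N, u} = {1..u-1}" using u by (auto simp: brk_def)
  ultimately have "saturated B' {1..u-1}" by simp
  then have "saturated B {1..u-1}" unfolding B_eq by (rule saturated_drop) (use u in auto)
  then have "saturated (Bone B) {1..u-1}"
    using uh by (intro saturated_outside_Bone[OF PN istar s(1)]) auto
  then have c: "case_i N B" "uB N B = u"
    using uB_case_i[OF PN filled istar _ _ sat] u uh by auto
  have "B \<in> Xp N" using drop_basics(5,6) c s by (simp add: Xp_def condII_def suppB_def)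
  moreover have "arcs B' = insert (N, u) (arcs B)" "(N, u) \<notin> arcs B"
  proof -
    have "(i, j) = (N, u)" if "(i, j) \<in> arcs B'" "i = N \<or> j = N" for i j
      using arcs_eq[OF PN' that(1) arc, of N] that(2) by auto
    then have "(i, j) \<in> arcs B' \<longleftrightarrow> (i, j) = (N, u) \<or> (i, j) \<in> arcs B" for i j
      unfolding B_eq arcs_drop using arc by blast
    then show "arcs B' = insert (N, u) (arcs B)"
      unfolding set_eq_iff split_paired_All insert_iff by blast
    show "(N, u) \<notin> arcs B" by (simp add: B_eq arcs_drop)
  qed
  then have "wsum N B' = sdiff (wsum N B) (brk N N u)" by (intro wsum_insert finite_arcs[OF PN])
  \<comment> \<open>\<open>eps\<close> adds {N} and [1, u] one after the other; as they are
    disjoint, this amounts to adding [[Nu]].\<close>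
  moreover have "brk N N u = {N} \<union> {1..u}" "{N} \<inter> {1..u} = {}" using u by (auto simp: brk_def)
  moreover have "B \<notin> Xm N" using Xm_N drop_basics(6) by blast
  ultimately show ?thesis using c s u card by (simp add: Xp_lift_def eps_def sdiff_disjoint_union)
qed

text \<open>Here B^0 is unchanged. The interval [u, N] is a union of odd pairs, so it contains
  neither v nor an end of an even pair; hence u comes after the last entry of the sequence, which is
  case (ii).\<close>

lemma drop_one_arc:
  assumes arc: "(u, N) \<in> arcs B'"
  shows "Xp_lift N B B'"
proof -
  note PN = drop_basics(1) and PN' = drop_basics(2) and filled = drop_basics(3) and filled' = drop_basics(4)
  define l where "l = iseq N B"
  have istar: "istar_seq N B l" using drop_basics(7) by (simp add: l_def)
  have u: "1 \<le> u" "u < N" "even u" using arc_N_parity(2)[OF odd PN' arc] PN_arc[OF PN' arc] by auto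
  have only: "P = {u, N}" if "P \<in> B'" "N \<in> P" for P
    using PN_disjoint[OF PN' \<open>P \<in> B'\<close> PN_arc(6)[OF PN' arc], of N] that by simp
  have "N \<notin> P" if P: "P \<in> Bzero B'" for P
    using Bone_Bzero_disjoint[OF PN' _ arc_Bone[OF arc u(2)] _ P, of N] by auto
  then have Bz: "Bzero B' = Bzero B" unfolding B_eq Bzero_drop by (auto simp: drop_point_def)
  have s: "card (Bzero B) > 0" "odd (card (Bzero B))"
    using N_in_wsum(2)[OF odd B' arc] Nw Bz by (auto intro: Nat.gr0I)
  note ends = istar_ends[OF PN istar s(1)]
  have ends': "(last l, hd l) \<in> arcs B'" "last l \<noteq> N" using ends(4) by (auto simp: B_eq arcs_drop)
  have lN: "last l < N" "1 \<le> hd l" using PN_arc[OF PN ends(4)] ends'(2) by auto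
  have hv: "hd l < v" "v < last l" using Good_zero_arc[OF B' v(3,1,2) ends'(1) ends(5)] by auto
  have uN: "saturated (Bone B') {u..N}" using filled' arc u by (auto simp: filled_def)
  then have uN': "saturated B' {u..N}" by (rule saturated_mono[OF _ Bone_subset])
  have "v \<notin> {u..N}" using saturated_notin[OF uN' v(3)] .
  then have vu: "v < u" using v by auto
  have "last l \<notin> {u..N}"
  proof
    assume "last l \<in> {u..N}"
    then obtain P where P: "P \<in> Bone B'" "last l \<in> P" by (rule saturatedE[OF uN])
    show False
      using Bone_Bzero_disjoint[OF PN' P(2,1) _ arc_Bzero[OF ends'(1) ends(5)]] by simp
  qed
  then have lu: "last l < u" using lN by auto
  have "saturated B' (brk N (last l) (hd l) - {last l, hd l} - {u..N})"
    by (rule saturated_diff[OF PN' subset_refl saturated_diff[OF PN' subset_refl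
          Good_saturated[OF B' ends'(1)] saturated_block[OF PN_arc(6)[OF PN' ends'(1)]]] uN'])
  moreover have "brk N (last l) (hd l) - {last l, hd l} - {u..N} = {1..hd l - 1} \<union> {last l + 1..u - 1}"
    using ends(5) lN lu u by (auto simp: brk_def)
  ultimately have "saturated B' ({1..hd l - 1} \<union> {last l + 1..u - 1})" by simp
  then have "saturated B ({1..hd l - 1} \<union> {last l + 1..u - 1})"
    unfolding B_eq by (rule saturated_drop) (use u lN ends(5) in auto)
  then have "saturated (Bone B) ({1..hd l - 1} \<union> {last l + 1..u - 1})"
    using lN(2) by (intro saturated_outside_Bone[OF PN istar s(1)]) auto
  note split = saturated_split[OF PN filled drop_basics(8) this]
  have "({1..hd l - 1} \<union> {last l + 1..u - 1}) \<inter> {..<v} = {1..hd l - 1}"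
    "({1..hd l - 1} \<union> {last l + 1..u - 1}) \<inter> {v<..} = {last l + 1..u - 1}"
    using hv by auto
  then have sat: "saturated (Bone B) {1..hd l - 1}" "saturated (Bone B) {last l + 1..u - 1}"
    using split by simp_all
  have "saturated (Bone B') ({u..N} - {u, N})"
    by (rule saturated_diff[OF PN' Bone_subset uN saturated_block[OF arc_Bone[OF arc u(2)]]])
  moreover have "{u..N} - {u, N} = {u+1..N-1}" using u by auto
  ultimately have "saturated (Bone B') {u+1..N-1}" by simp
  then have "saturated (Bone B) {u+1..N-1}" unfolding B_eq Bone_drop by (rule saturated_drop) (use u in auto)
  then have c: "case_ii N B" "uB N B = u"
    using uB_case_ii[OF PN filled istar _ sat(2) _ sat(1)] u lu by auto
  have "B \<in> Xp N" using drop_basics(5,6) c s by (simp add: Xp_def condII_def suppB_def)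
  moreover have "arcs B' = insert (u, N) (arcs B)" "(u, N) \<notin> arcs B"
  proof -
    have "(i, j) = (u, N)" if "(i, j) \<in> arcs B'" "i = N \<or> j = N" for i j
      using arcs_eq[OF PN' that(1) arc, of N] that(2) by auto
    then have "(i, j) \<in> arcs B' \<longleftrightarrow> (i, j) = (u, N) \<or> (i, j) \<in> arcs B" for i j
      unfolding B_eq arcs_drop using arc by blast
    then show "arcs B' = insert (u, N) (arcs B)"
      unfolding set_eq_iff split_paired_All insert_iff by blast
    show "(u, N) \<notin> arcs B" by (simp add: B_eq arcs_drop)
  qed
  then have "wsum N B' = sdiff (wsum N B) (brk N u N)" by (intro wsum_insert finite_arcs[OF PN])
  moreover have "brk N u N = {u..N}" using u by (auto simp: brk_def)
  moreover have "B \<notin> Xm N" using Xm_N drop_basics(6) by blast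
  ultimately show ?thesis using c s u Bz by (simp add: Xp_lift_def eps_def)
qed

end

lemma drop_Xp_lift:
  assumes odd: "odd N" and B: "B \<in> Good N" and Nw: "N \<notin> wsum N B"
  shows "Xp_lift N (drop_point N B) B"
proof -
  note PN = Good_PN[OF B]
  obtain v where v: "1 \<le> v" "v \<le> N" "v \<notin> \<Union>B" using free_point[OF odd PN] by blast
  consider u where "(N, u) \<in> arcs B" | u where "(u, N) \<in> arcs B" | "N \<notin> \<Union>B"
    using in_Union_arcs[OF PN] by blast
  then show ?thesis
    using drop_zero_arc[OF odd B Nw v refl] drop_one_arc[OF odd B Nw v refl]
      drop_unmatched[OF odd B Nw v refl] by cases
qed

text \<open>Arcs of old odd pairs are unions of blocks already. Arcs of old even pairs all contain
  the outer stretches, which become unions of blocks through the new pair; this is what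
  \<open>outer\<close> supplies.\<close>

lemma insert_pair_Good:
  assumes B: "B \<in> StarP N" and pq: "wr p q" "p \<in> {1..N}" "q \<in> {1..N}" "p \<notin> \<Union>B" "q \<notin> \<Union>B"
    and new: "saturated B (brk N p q - {p, q})"
    and outer: "card (Bzero B) > 0 \<Longrightarrow>
      saturated (insert {p, q} B) ({1..hd (iseq N B) - 1} \<union> {last (iseq N B) + 1..N})"
  shows "insert {p, q} B \<in> Good N"
proof -
  note PN = StarP_D(1)[OF B] and filled = StarP_D(2)[OF B] and istar = StarP_D(3)[OF B]
  let ?B = "insert {p, q} B"
  have "pairwise disjnt ?B"
    using PN pq(4,5) by (auto simp: PN_def pairwise_insert disjnt_iff)
  then have PN': "?B \<in> PN N"
    using PN pq(2,3) wr_neq[OF pq(1)] by (auto simp: PN_def)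
  have "saturated ?B (brk N i j)" if ij: "(i, j) \<in> arcs ?B" for i j
  proof (cases "(i, j) = (p, q)")
    case True
    have "saturated ?B ((brk N p q - {p, q}) \<union> {p, q})"
      by (rule saturated_Un[OF saturated_mono[OF new subset_insertI] saturated_block]) simp
    moreover have "(brk N p q - {p, q}) \<union> {p, q} = brk N p q"
      using pq wr_neq[OF pq(1)] by (auto simp: brk_def)
    ultimately show ?thesis using True by simp
  next
    case False
    then have ij: "(i, j) \<in> arcs B" using that arcs_insert[OF pq(1), of B] by auto
    show ?thesis
    proof (cases "i < j")
      case True
      then have "saturated (Bone B) {i..j}" using filled ij by (simp add: filled_def)
      moreover have "Bone B \<subseteq> ?B" using Bone_subset by blast
      ultimately show ?thesis using True saturated_mono by (simp add: brk_def)
    next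
      case False
      then have ji: "j < i" using PN_arc(5)[OF PN ij] by simp
      obtain k where "k < card (Bzero B)" by (rule istar_zero_arc[OF PN istar ij ji])
      then have "card (Bzero B) > 0" by simp
      then show ?thesis by (rule istar_saturated[OF PN istar filled subset_insertI outer ij ji])
    qed
  qed
  then show ?thesis using PN' by (simp add: Good_def)
qed

lemma drop_insert:
  assumes "N \<in> P" "N \<notin> \<Union>B"
  shows "drop_point N (insert P B) = B"
  using assms by (auto simp: drop_point_def)

text \<open>A point whose two neighbouring stretches are closed under the matching can only be
  matched across a stretch end; the ends \<open>p - 1\<close> and \<open>q + 1\<close> are unavailable because
  they are endpoints of pairs in \<open>Bzero B\<close>, or \<open>0\<close>, or the unmatched point \<open>N\<close>.\<close>
lemma gap_unmatched:
  assumes PN: "B \<in> PN N" and filled: "filled B" and u: "u \<in> {p..q}"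
    and sat: "saturated (Bone B) {p..u-1}" "saturated (Bone B) {u+1..q}"
    and left: "p - 1 = 0 \<or> p - 1 \<notin> \<Union>(Bone B)" and right: "q + 1 \<notin> \<Union>(Bone B)"
  shows "u \<notin> \<Union>(Bone B)"
proof
  assume "u \<in> \<Union>(Bone B)"
  then obtain P where P: "P \<in> Bone B" "u \<in> P" by blast
  obtain a b where ab: "(a, b) \<in> arcs B" "a < b" "P = {a, b}" by (rule Bone_pair[OF PN P(1)])
  have only: "Q = P" if "Q \<in> Bone B" "x \<in> Q" "x \<in> P" for Q x
    using PN_disjoint[OF PN _ _ that(2,3)] that(1) P(1) Bone_subset by blast
  have ab_sat: "saturated (Bone B) {a..b}" using filled ab by (simp add: filled_def)
  have a: "1 \<le> a" using PN_arc[OF PN ab(1)] by simp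
  consider "u = a" "b \<in> {u+1..q}" | "u = a" "q + 1 \<in> {a..b}" | "u = b" "a \<in> {p..u-1}" | "u = b" "p - 1 \<in> {a..b}" "p - 1 \<noteq> 0"
    using P(2) ab(2,3) u a by fastforce
  then show False
  proof cases
    case 1
    obtain Q where Q: "Q \<in> Bone B" "b \<in> Q" "Q \<subseteq> {u+1..q}" by (rule saturatedE[OF sat(2) 1(2)])
    have "Q = P" using only[OF Q(1,2)] ab(3) by simp
    then show False using Q(3) P(2) by auto
  next
    case 2
    obtain Q where "Q \<in> Bone B" "q + 1 \<in> Q" by (rule saturatedE[OF ab_sat 2(2)])
    then show False using right by blast
  next
    case 3
    obtain Q where Q: "Q \<in> Bone B" "a \<in> Q" "Q \<subseteq> {p..u-1}" by (rule saturatedE[OF sat(1) 3(2)])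
    have "Q = P" using only[OF Q(1,2)] ab(3) by simp
    then have "u \<in> {p..u-1}" using Q(3) P(2) by blast
    moreover have "1 \<le> u" using 3(1) a ab(2) by simp
    ultimately show False by auto
  next
    case 4
    obtain Q where "Q \<in> Bone B" "p - 1 \<in> Q" by (rule saturatedE[OF ab_sat 4(2)])
    then show False using left 4(3) by blast
  qed
qed

text \<open>It is enough to find a good \<open>B'\<close> with N outside its sum from which B arises
  by dropping the pair of N: the values of \<open>eps\<close> and \<open>uB\<close> then follow from
  \<open>drop_Xp_lift\<close>.\<close>

lemma Xp_lift_exists:
  assumes odd: "odd N" and B: "B \<in> Xp N"
  shows "\<exists>B'\<in>Good N. Xp_lift N B B' \<and> N \<notin> wsum N B' \<and> B = drop_point N B'"
proof -
  have star: "B \<in> StarP N" and NB: "N \<notin> \<Union>B" using B by (auto simp: Xp_def condII_def suppB_def)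
  note PN = StarP_D(1)[OF star] and filled = StarP_D(2)[OF star]
  define l where "l = iseq N B"
  have istar: "istar_seq N B l" using StarP_D(3)[OF star] by (simp add: l_def)
  have N: "1 \<le> N" using odd by (auto simp: Suc_le_eq odd_pos)
  have "\<exists>B'\<in>Good N. N \<notin> wsum N B' \<and> B = drop_point N B'"
  proof (cases "card (Bzero B) = 0")
    case True
    then have "B \<in> Good N" using StarP_condI_Good[OF star] by (simp add: condI_def)
    moreover have "B = drop_point N B" using NB by (auto simp: drop_point_def)
    ultimately show ?thesis using N_in_wsum(3)[OF odd _ NB] by blast
  next
    case False
    then have s: "card (Bzero B) > 0" by simp
    have so: "odd (card (Bzero B))" and cases: "case_i N B \<or> case_ii N B"
      using B False by (auto simp: Xp_def condII_def)
    note ends = istar_ends[OF PN istar s]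
    have b: "1 \<le> hd l" "last l \<le> N" using PN_arc[OF PN ends(4)] by auto
    have "last l \<noteq> N" using NB ends(4) by (auto simp: arcs_def)
    then have lN: "last l < N" using b by simp
    have zero_end: "x \<notin> \<Union>(Bone B)" if "x \<in> {last l, hd l}" for x
      using Bone_Bzero_disjoint[OF PN _ _ that arc_Bzero[OF ends(4,5)]] by blast
    have N_end: "N \<notin> \<Union>(Bone B)" using NB Bone_subset by blast
    have unmatched: "u \<notin> \<Union>B" if "u \<notin> \<Union>(Bone B)" "u < hd l \<or> last l < u" for u
    proof
      assume "u \<in> \<Union>B"
      then obtain P where P: "P \<in> B" "u \<in> P" by blast
      then have "P \<in> Bzero B" using Bone_or_Bzero[OF PN P(1)] that(1) by blast
      then have "hd l \<le> u" "u \<le> last l" using istar_bounds[OF PN istar s, of u] P(2) by auto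
      then show False using that(2) by simp
    qed
    note cov = cov0_iff[OF PN filled]
    from cases show ?thesis
    proof
      assume "case_i N B"
      then have "cov1 B {1..hd l - 1}" and R: "saturated (Bone B) {last l + 1..N - 1}"
        by (simp_all add: case_i_def Let_def cov flip: l_def)
      then obtain u where u: "u \<in> {1..hd l - 1}" "saturated (Bone B) {1..u-1}" "saturated (Bone B) {u+1..hd l - 1}"
        using cov1_iff[OF PN filled, of 1] by auto
      have ul: "1 \<le> u" "u < hd l" using u(1) by auto
      have uN: "u < N" using ul ends(5) lN by simp
      \<comment> \<open>The parity of u decides how the new pair is written: u - 1 is even, so u is
        odd and the pair is Nu.\<close>
      have "even (card {1..u-1})" using even_card_saturated'[OF PN Bone_subset u(2)] .
      then have "odd u" using ul by simp
      then have wr: "wr N u" using odd uN by (auto simp: wr_def)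
      have "u \<notin> \<Union>(Bone B)"
        using gap_unmatched[OF PN filled u] zero_end[of "hd l"] b by simp
      then have uB: "u \<notin> \<Union>B" using unmatched ul by blast
      have "brk N N u - {N, u} = {1..u-1}" using uN by (auto simp: brk_def)
      then have new: "saturated B (brk N N u - {N, u})" using saturated_mono[OF u(2) Bone_subset] by simp
      have "saturated B ({1..u-1} \<union> {u+1..hd l - 1} \<union> {last l + 1..N - 1})"
        by (intro saturated_Un saturated_mono[OF u(2) Bone_subset] saturated_mono[OF u(3) Bone_subset]
            saturated_mono[OF R Bone_subset])
      then have "saturated (insert {N, u} B) (({1..u-1} \<union> {u+1..hd l - 1} \<union> {last l + 1..N - 1}) \<union> {N, u})"
        by (rule saturated_Un[OF saturated_mono[OF _ subset_insertI] saturated_block]) simp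
      moreover have "({1..u-1} \<union> {u+1..hd l - 1} \<union> {last l + 1..N - 1}) \<union> {N, u} = {1..hd l - 1} \<union> {last l + 1..N}"
        using ul lN by auto
      ultimately have outer: "saturated (insert {N, u} B) ({1..hd l - 1} \<union> {last l + 1..N})" by simp
      let ?B = "insert {N, u} B"
      have G: "?B \<in> Good N"
        using outer N ul uN by (intro insert_pair_Good[OF star wr _ _ NB uB new]) (auto simp: l_def)
      have arc: "(N, u) \<in> arcs ?B" using wr by (simp add: arcs_def)
      have "drop_point N ?B = B" using NB by (intro drop_insert) auto
      have "Bzero ?B = insert {N, u} (Bzero B)"
      proof -
        have "{N, u} \<in> Bzero ?B" by (rule arc_Bzero[OF arc uN])
        then show ?thesis unfolding Bzero_def by blast
      qed
      moreover have "{N, u} \<notin> Bzero B" using NB Bzero_subset by blast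
      moreover have "finite (Bzero B)" using s by (simp add: card_gt_0_iff)
      ultimately have "card (Bzero ?B) = Suc (card (Bzero B))" by simp
      then have "N \<notin> wsum N ?B" using N_in_wsum(1)[OF odd G arc] so by simp
      then show ?thesis using G \<open>drop_point N ?B = B\<close> by (intro bexI[of _ ?B]) simp_all
    next
      assume "case_ii N B"
      then have "cov1 B {last l + 1..N - 1}" and L: "saturated (Bone B) {1..hd l - 1}"
        by (simp_all add: case_ii_def Let_def cov flip: l_def)
      then obtain u where u: "u \<in> {last l + 1..N - 1}" "saturated (Bone B) {last l + 1..u-1}" "saturated (Bone B) {u+1..N - 1}"
        using cov1_iff[OF PN filled, of "last l + 1"] by auto
      have ul: "last l < u" "u < N" using u(1) lN by auto
      have "even (card {u+1..N-1})" using even_card_saturated'[OF PN Bone_subset u(3)] .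
      then have "odd (N - u)" using ul by (simp add: even_diff_nat)
      then have wr: "wr u N" using ul by (auto simp: wr_def)
      have "u \<notin> \<Union>(Bone B)"
        using gap_unmatched[OF PN filled u] zero_end[of "last l"] N_end N by simp
      then have uB: "u \<notin> \<Union>B" using unmatched ul by blast
      have "brk N u N - {u, N} = {u+1..N-1}" using ul by (auto simp: brk_def)
      then have new: "saturated B (brk N u N - {u, N})" using saturated_mono[OF u(3) Bone_subset] by simp
      have "saturated B ({1..hd l - 1} \<union> {last l + 1..u - 1} \<union> {u+1..N - 1})"
        by (intro saturated_Un saturated_mono[OF u(2) Bone_subset] saturated_mono[OF u(3) Bone_subset]
            saturated_mono[OF L Bone_subset])
      then have "saturated (insert {u, N} B) (({1..hd l - 1} \<union> {last l + 1..u - 1} \<union> {u+1..N - 1}) \<union> {u, N})"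
        by (rule saturated_Un[OF saturated_mono[OF _ subset_insertI] saturated_block]) simp
      moreover have "({1..hd l - 1} \<union> {last l + 1..u - 1} \<union> {u+1..N - 1}) \<union> {u, N} = {1..hd l - 1} \<union> {last l + 1..N}"
        using ul by auto
      ultimately have outer: "saturated (insert {u, N} B) ({1..hd l - 1} \<union> {last l + 1..N})" by simp
      let ?B = "insert {u, N} B"
      have G: "?B \<in> Good N"
        using outer N ul by (intro insert_pair_Good[OF star wr _ _ uB NB new]) (auto simp: l_def)
      have arc: "(u, N) \<in> arcs ?B" using wr by (simp add: arcs_def)
      have "drop_point N ?B = B" using NB by (intro drop_insert) auto
      have "{u, N} \<notin> Bzero ?B"
        using Bone_Bzero_disjoint[OF Good_PN[OF G] _ arc_Bone[OF arc ul(2)], of u "{u, N}"] by auto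
      then have "Bzero ?B = Bzero B" unfolding Bzero_def by blast
      then have "N \<notin> wsum N ?B" using N_in_wsum(2)[OF odd G arc] so by simp
      then show ?thesis using G \<open>drop_point N ?B = B\<close> by (intro bexI[of _ ?B]) simp_all
    qed
  qed
  then show ?thesis using drop_Xp_lift[OF odd] by blast
qed

section \<open>The bijections and their gradings\<close>

lemma Xp_bij:
  assumes odd: "odd N"
  shows "bij_betw (eps N) (Xp N) (ENp N)"
proof (rule bij_betwI')
  fix B C assume B: "B \<in> Xp N" and C: "C \<in> Xp N"
  obtain B' where B': "B' \<in> Good N" "Xp_lift N B B'" "B = drop_point N B'"
    using Xp_lift_exists[OF odd B] by blast
  obtain C' where C': "C' \<in> Good N" "Xp_lift N C C'" "C = drop_point N C'"
    using Xp_lift_exists[OF odd C] by blast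
  show "eps N B = eps N C \<longleftrightarrow> B = C"
    using wsum_inj[OF odd B'(1) C'(1)] B'(2,3) C'(2,3) by (auto simp: Xp_lift_def)
next
  fix B assume B: "B \<in> Xp N"
  obtain B' where B': "B' \<in> Good N" "Xp_lift N B B'" "N \<notin> wsum N B'"
    using Xp_lift_exists[OF odd B] by blast
  then show "eps N B \<in> ENp N" using Good_wsum_EN[OF odd B'(1)] by (simp add: ENp_def Xp_lift_def)
next
  fix X assume "X \<in> ENp N"
  then have X: "X \<in> EN N" "N \<notin> X" by (auto simp: ENp_def)
  then obtain B' where B': "B' \<in> Good N" "wsum N B' = X"
    using wsum_bij[OF odd] by (metis bij_betw_imp_surj_on imageE)
  then show "\<exists>B\<in>Xp N. X = eps N B"
    using drop_Xp_lift[OF odd B'(1)] X(2) by (auto simp: Xp_lift_def)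
qed

lemma eps_Xm: "B \<in> Xm N \<Longrightarrow> eps N B = wsum N B"
  by (simp add: eps_def)

lemma Xm_bij:
  assumes odd: "odd N"
  shows "bij_betw (eps N) (Xm N) (ENm N)"
proof -
  have "wsum N ` {B \<in> Good N. N \<in> wsum N B} = ENm N"
    using bij_betw_imp_surj_on[OF wsum_bij[OF odd]] by (auto simp: ENm_def)
  then have "bij_betw (wsum N) (Xm N) (ENm N)"
    using bij_betw_imp_inj_on[OF wsum_bij[OF odd]] unfolding Xm_eq[OF odd] bij_betw_def
    by (auto intro: inj_on_subset)
  then show ?thesis using eps_Xm by (subst bij_betw_cong[where g = "wsum N"]) auto
qed

text \<open>Taken at |B^0| of a good matching this is \<open>gam\<close> of its sum; the shift in
  the odd case is the origin of the index -t - 1.\<close>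

lemma two_zig: "2 * zig k = (if even k then int k else - int k - 1)"
  by (auto simp: zig_def elim!: evenE oddE)

text \<open>For odd u_B the completion has |B^0| + 1 even pairs, an even number, so t = |B^0| + 1.
  For even u_B it has |B^0|, an odd number, so t = -|B^0| - 1.\<close>

lemma Xtp_eq:
  assumes odd: "odd N" and t: "even t"
  shows "Xtp N t = {B \<in> Xp N. gam (eps N B) = t}"
proof -
  have "B \<in> Xtp N t \<longleftrightarrow> gam (eps N B) = t" if B: "B \<in> Xp N" for B
  proof -
    obtain B' where B': "B' \<in> Good N" "Xp_lift N B B'" using Xp_lift_exists[OF odd B] by blast
    have g: "gam (eps N B) = 2 * zig (card (Bzero B'))"
      using Good_gam[OF odd B'(1)] B'(2) by (simp add: Xp_lift_def)
    consider "card (Bzero B) = 0" "card (Bzero B') = 0"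
      | "odd (card (Bzero B))" "odd (uB N B)" "card (Bzero B') = Suc (card (Bzero B))"
      | "odd (card (Bzero B))" "even (uB N B)" "card (Bzero B') = card (Bzero B)"
      using B'(2) unfolding Xp_lift_def by metis
    then show ?thesis
    proof cases
      case 1
      then show ?thesis using B t g by (auto simp: Xtp_def two_zig)
    next
      case 2
      then have "card (Bzero B) > 0" by (auto intro: Nat.gr0I)
      then show ?thesis using 2 B t g by (auto simp: Xtp_def two_zig)
    next
      case 3
      then have "card (Bzero B) > 0" by (auto intro: Nat.gr0I)
      then show ?thesis using 3 B t g by (auto simp: Xtp_def two_zig)
    qed
  qed
  moreover have "Xtp N t \<subseteq> Xp N" by (auto simp: Xtp_def)
  ultimately show ?thesis by blast
qed

lemma Xtm_eq:
  assumes odd: "odd N" and t: "even t"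
  shows "Xtm N t = {B \<in> Xm N. gam (eps N B) = t}"
proof -
  have "B \<in> Xtm N t \<longleftrightarrow> gam (eps N B) = t" if B: "B \<in> Xm N" for B
  proof -
    have G: "B \<in> Good N" using B Xm_eq[OF odd] by blast
    have g: "gam (eps N B) = (if even (card (Bzero B)) then int (card (Bzero B)) else - int (card (Bzero B)) - 1)"
      using Good_gam[OF odd G] eps_Xm[OF B] two_zig by simp
    show ?thesis
    proof (cases "even (card (Bzero B))")
      case True
      then have "\<exists>i. even i \<and> {i, N} \<in> B" using B by (auto simp: Xm_def condIII_def)
      moreover have "\<not> int (card (Bzero B)) = - t - 1"
      proof
        assume "int (card (Bzero B)) = - t - 1"
        then have "even (- t - 1)" using True by (metis even_of_nat_iff)
        then show False using t by simp
      qed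
      ultimately show ?thesis using B g True by (auto simp: Xtm_def)
    next
      case False
      then have "\<exists>i. odd i \<and> {i, N} \<in> B" using B by (auto simp: Xm_def condIII_def)
      moreover have "int (card (Bzero B)) \<noteq> t" "card (Bzero B) > 0"
        using False t by (auto intro: Nat.gr0I)
      ultimately show ?thesis using B g False by (auto simp: Xtm_def)
    qed
  qed
  moreover have "Xtm N t \<subseteq> Xm N" by (auto simp: Xtm_def)
  ultimately show ?thesis by blast
qed

lemma bij_betw_Collect:
  assumes "bij_betw f A B"
  shows "bij_betw f {x \<in> A. Q (f x)} {y \<in> B. Q y}"
  using assms unfolding bij_betw_def by (auto intro: inj_on_subset)

theorem theorem2p13:
  fixes N :: nat
  assumes "odd N" and "N \<ge> 3"
  shows "bij_betw (eps N) (Xp N) (ENp N) \<and> bij_betw (eps N) (Xm N) (ENm N) \<and>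
         (\<forall>t::int. even t \<longrightarrow>
            bij_betw (eps N) (Xtp N t) (ENtp N t) \<and> bij_betw (eps N) (Xtm N t) (ENtm N t))"
proof (intro conjI allI impI)
  show "bij_betw (eps N) (Xp N) (ENp N)" "bij_betw (eps N) (Xm N) (ENm N)"
    using Xp_bij Xm_bij assms(1) by blast+
  fix t :: int assume t: "even t"
  show "bij_betw (eps N) (Xtp N t) (ENtp N t)" "bij_betw (eps N) (Xtm N t) (ENtm N t)"
    unfolding ENtp_def ENtm_def Xtp_eq[OF assms(1) t] Xtm_eq[OF assms(1) t]
    by (rule bij_betw_Collect[OF Xp_bij[OF assms(1)]] bij_betw_Collect[OF Xm_bij[OF assms(1)]])+
qed

end
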